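(* Let the coefficients $a_{jk}$ ($j,k=1,\dots,n$) on $[0,T]\times\mathbb R^n$ satisfy the standing hypotheses (H1)--(H3) listed in the context, and consider the equation $$\partial_t u-\sum_{j,k=1}^n\partial_{x_j}(a_{jk}(t,x)\partial_{x_k}u)=0 \quad\text{on }[0,T]\times\mathbb R^n. \qquad (\mathrm P)$$ Let $U(p,s)$, $M$, $b_\alpha$ be as in the context. Let $E>0$ and let $\bar u\colon[0,T]\to H^1(\mathbb R^n)$ be an (unknown) solution of $(\mathrm P)$ with $\|\bar u(0)\|_{H^1}\le E$. Let $E':=(1+E)/\kappa^2$. Let $\rho$, $\theta$ and $K$ be the positive constants given by the conditional stability theorem recalled in the context when $E$ is replaced by $E'$. Let $\delta>0$, let $g\in L^2(\mathbb R^n)$ be a measurement of $\bar u(T)$ with $\|g-\bar u(T)\|_{L^2}<\delta$, and let $u_{g,\delta}\in H^1(\mathbb R^n)$ be the unique solution of $$b_\alpha(u_{g,\delta},h)=\langle U(T,0)^*g,h\rangle_{L^2}\quad\text{for all }h\in H^1(\mathbb R^n),\qquad \alpha=\delta M\kappa.$$ Let $u(t):=U(t,0)u_{g,\delta}$. Then, if $\delta$ is so small that $\frac{M^{1/2}}{\kappa}(1+E)\delta^{1/2}<\rho$, the estimate $$\sup_{t\in[0,T]}\|u(t)-\bar u(t)\|_{L^2}\le K'\,\frac{1}{|\log\delta|^{\theta}}$$ holds true, where $K'$ is a constant which can be explicitly expressed in terms of $K$, $\theta$, $\kappa$, $M$ and $E$.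
   Context: Standing hypotheses: (H1) $a_{jk}(t,x)=a_{kj}(t,x)$ for all $(t,x)\in[0,T]\times\mathbb R^n$ and all $j,k$; (H2) there is $\kappa$, $0<\kappa\le1$, with $\kappa|\xi|^2\le\sum_{j,k}a_{jk}(t,x)\xi_j\xi_k\le\frac1\kappa|\xi|^2$ for all $(t,x,\xi)\in[0,T]\times\mathbb R^n\times\mathbb R^n$; (H3) each $a_{jk}$ is Log-Lipschitz in $t$ with values in $L^\infty(\mathbb R^n)$ and belongs to $L^\infty([0,T],\mathrm{Lip}(\mathbb R^n))$. Set $$A_{LL}:=\sup\Bigl\{\tfrac{|a_{jk}(t,x)-a_{jk}(s,x)|}{|t-s|(1+|\log|t-s||)}: j,k=1,\dots,n,\ t,s\in[0,T],\ x\in\mathbb R^n,\ 0<|t-s|\le1\Bigr\},$$ $$A:=\sup\{\|\partial_x^\beta a_{jk}(t,\cdot)\|_{L^\infty}: j,k=1,\dots,n,\ |\beta|\le1,\ t\in[0,T]\}.$$ Function spaces are over $\mathbb R^n$ and $\langle\cdot,\cdot\rangle_{L^2}$ is the $L^2$ scalar product. For $t\in[0,T]$ and $u,v\in H^1$, $a(t;u,v):=\int_{\mathbb R^n}\sum_{j,k}a_{jk}(t,x)\,\partial_{x_j}u\,\partial_{x_k}v\,dx$. Evolution operators (known background): there is a family $U(p,s)$, $0\le s\le p\le T$, of evolution operators for $(\mathrm P)$ such that $U(s,s)=I$, $U(p,q)U(q,s)=U(p,s)$ for $s\le q\le p$, and, for some constant $M>0$, $\|U(p,s)\|_{\mathcal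 L(H^\sigma,H^\sigma)}\le M$ for all $\sigma\in[0,2]$ and $\|U(p,s)\|_{\mathcal L(H^{\sigma_1},H^{\sigma_2})}\le M(1+(p-s)^{-(\sigma_2-\sigma_1)})$ for $s<p$, $0\le\sigma_1<\sigma_2\le2$. For $u_s\in H^\sigma$, $0\le\sigma\le2$, the function $u(p)=U(p,s)u_s$ is continuous from $[s,T]$ to $H^\sigma$, continuous from $]s,T]$ to $H^2$, differentiable from $]s,T]$ to $L^2$, and satisfies $(\mathrm P)$ in $L^2$ on $]s,T]$ with $u(s)=u_s$. $M$ denotes this constant throughout, and $U(T,0)^*$ denotes the adjoint of $U(T,0)$ in $L^2$. For $\alpha>0$ and $u,v\in H^1$, $$b_\alpha(u,v):=\alpha\bigl(a(0;u,v)+\langle u,v\rangle_{L^2}\bigr)+\langle U(T,0)u,U(T,0)v\rangle_{L^2}.$$ By the Lax-Milgram theorem, $u_{g,\delta}$ exists and is unique. Conditional stability theorem up to $t=0$ (a previously known result): assume (H1)--(H3) and let $E>0$. There exist positive constants $\rho_E$, $\theta_E$ and $K_E$, depending only on $A_{LL}$, $A$, $\kappa$, $T$ and $E$, such that if $u,v\in C^0([0,T],H^1)\cap C^1(]0,T],L^2)$ are solutions of $(\mathrm P)$ satisfying $\|u(0)\|_{H^1}\le E$, $\|v(0)\|_{H^1}\le E$ and $\|u(T)-v(T)\|_{L^2}\le\rho_E$, then $$\sup_{t\in[0,T]}\|u(t)-v(t)\|_{L^2}\le K_E\,\frac{1}{\bigl|\log\|u(T)-v(T)\|_{L^2}\bigr|^{\theta_E}}.$$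 *)

theory Defs
  imports "HOL-Analysis.Analysis"
begin

section \<open>The Hilbert space of square-integrable functions\<close>

definition sq_integrable :: "(real^'n::finite \<Rightarrow> real) \<Rightarrow> bool" where
  "sq_integrable f \<longleftrightarrow> f \<in> borel_measurable lborel \<and> integrable lborel (\<lambda>x. (f x)\<^sup>2)"

definition L2_eq :: "(real^'n::finite \<Rightarrow> real) \<Rightarrow> (real^'n \<Rightarrow> real) \<Rightarrow> bool" where
  "L2_eq f g \<longleftrightarrow> sq_integrable f \<and> sq_integrable g \<and> (AE x in lborel. f x = g x)"

lemma sq_integrable_mult:
  assumes "sq_integrable f" "sq_integrable g"
  shows "integrable lborel (\<lambda>x. f x * g x)"
proof (rule Bochner_Integration.integrable_bound)
  show "integrable lborel (\<lambda>x. (f x)\<^sup>2 + (g x)\<^sup>2)"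
    using assms by (auto simp: sq_integrable_def)
  show "(\<lambda>x. f x * g x) \<in> borel_measurable lborel"
    using assms by (auto simp: sq_integrable_def)
  have "\<bar>f x * g x\<bar> \<le> (f x)\<^sup>2 + (g x)\<^sup>2" for x
  proof -
    have "2 * (\<bar>f x\<bar> * \<bar>g x\<bar>) \<le> \<bar>f x\<bar>\<^sup>2 + \<bar>g x\<bar>\<^sup>2"
      using sum_squares_bound[of "\<bar>f x\<bar>" "\<bar>g x\<bar>"] by (simp add: mult.assoc)
    moreover have "0 \<le> \<bar>f x\<bar> * \<bar>g x\<bar>" by simp
    ultimately show ?thesis by (simp only: abs_mult power2_abs)
  qed
  then show "AE x in lborel. norm (f x * g x) \<le> norm ((f x)\<^sup>2 + (g x)\<^sup>2)"
    by simp
qed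

lemma sq_integrable_zero: "sq_integrable (\<lambda>x. 0)"
  by (simp add: sq_integrable_def)

lemma sq_integrable_add:
  assumes "sq_integrable f" "sq_integrable g"
  shows "sq_integrable (\<lambda>x. f x + g x)"
  using assms sq_integrable_mult[OF assms]
  by (auto simp: sq_integrable_def power2_sum mult.assoc)

lemma sq_integrable_scale:
  assumes "sq_integrable f"
  shows "sq_integrable (\<lambda>x. c * f x)"
  using assms by (auto simp: sq_integrable_def power_mult_distrib)

quotient_type (overloaded) 'n L2 = "real^'n::finite \<Rightarrow> real" / partial: L2_eq
proof (rule part_equivpI)
  show "\<exists>f::real^'n \<Rightarrow> real. L2_eq f f"
    using sq_integrable_zero by (auto simp: L2_eq_def intro!: exI[of _ "\<lambda>x. 0"])
  show "symp (L2_eq :: (real^'n \<Rightarrow> real) \<Rightarrow> _)"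
    by (rule sympI) (auto simp: L2_eq_def)
  show "transp (L2_eq :: (real^'n \<Rightarrow> real) \<Rightarrow> _)"
    by (rule transpI) (auto simp: L2_eq_def)
qed

instantiation L2 :: (finite) real_inner
begin

lift_definition zero_L2 :: "'a L2" is "\<lambda>x. 0"
  by (simp add: L2_eq_def sq_integrable_zero)

lift_definition plus_L2 :: "'a L2 \<Rightarrow> 'a L2 \<Rightarrow> 'a L2" is "\<lambda>f g x. f x + g x"
  by (auto simp: L2_eq_def intro: sq_integrable_add)

lift_definition scaleR_L2 :: "real \<Rightarrow> 'a L2 \<Rightarrow> 'a L2" is "\<lambda>c f x. c * f x"
  by (simp add: L2_eq_def) (auto intro: sq_integrable_scale)

lift_definition inner_L2 :: "'a L2 \<Rightarrow> 'a L2 \<Rightarrow> real"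
  is "\<lambda>f g. \<integral>x. f x * g x \<partial>lborel"
  by (rule integral_cong_AE) (auto simp: L2_eq_def sq_integrable_def)

definition uminus_L2 :: "'a L2 \<Rightarrow> 'a L2" where "uminus_L2 u = (-1) *\<^sub>R u"
definition minus_L2 :: "'a L2 \<Rightarrow> 'a L2 \<Rightarrow> 'a L2" where "minus_L2 u v = u + (- v)"
definition norm_L2 :: "'a L2 \<Rightarrow> real" where "norm_L2 u = sqrt (u \<bullet> u)"
definition sgn_L2 :: "'a L2 \<Rightarrow> 'a L2" where "sgn_L2 u = inverse (norm u) *\<^sub>R u"
definition dist_L2 :: "'a L2 \<Rightarrow> 'a L2 \<Rightarrow> real" where "dist_L2 u v = norm (u - v)"
definition uniformity_L2 :: "('a L2 \<times> 'a L2) filter"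
  where "uniformity_L2 = (INF e\<in>{0<..}. principal {(x, y). dist x y < e})"
definition open_L2 :: "'a L2 set \<Rightarrow> bool"
  where "open_L2 S \<longleftrightarrow> (\<forall>x\<in>S. \<forall>\<^sub>F (x', y) in uniformity. x' = x \<longrightarrow> y \<in> S)"

instance
proof
  fix u v w :: "'a L2" and c d :: real
  show "u + v + w = u + (v + w)"
    by transfer (auto simp: L2_eq_def add.assoc intro!: sq_integrable_add)
  show "u + v = v + u"
    by transfer (auto simp: L2_eq_def add.commute intro!: sq_integrable_add)
  show zl: "0 + u = u" for u :: "'a L2"
    by transfer (auto simp: L2_eq_def)
  show "- u + u = 0"
    unfolding uminus_L2_def
    by transfer (auto simp: L2_eq_def sq_integrable_zero
        intro!: sq_integrable_add dest: sq_integrable_scale[of _ "-1"])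
  show "u - v = u + - v" by (simp add: minus_L2_def)
  show "c *\<^sub>R (u + v) = c *\<^sub>R u + c *\<^sub>R v"
    by transfer (auto simp: L2_eq_def algebra_simps
        intro!: sq_integrable_add sq_integrable_scale)
  show "(c + d) *\<^sub>R u = c *\<^sub>R u + d *\<^sub>R u"
    by transfer (auto simp: L2_eq_def distrib_right
        intro!: sq_integrable_add sq_integrable_scale)
  show "c *\<^sub>R d *\<^sub>R u = (c * d) *\<^sub>R u"
    by transfer (auto simp: L2_eq_def mult.assoc
        intro!: sq_integrable_scale dest: sq_integrable_scale)
  show "1 *\<^sub>R u = u"
    by transfer (auto simp: L2_eq_def)
  show "dist u v = norm (u - v)" by (simp add: dist_L2_def)
  show "sgn u = inverse (norm u) *\<^sub>R u" by (simp add: sgn_L2_def)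
  show "uniformity = (INF e\<in>{0<..}. principal {(x::'a L2, y). dist x y < e})"
    by (simp add: uniformity_L2_def)
  show "open S \<longleftrightarrow> (\<forall>x\<in>S. \<forall>\<^sub>F (x', y) in uniformity. x' = x \<longrightarrow> y \<in> S)"
    for S :: "'a L2 set" by (simp add: open_L2_def)
  show "u \<bullet> v = v \<bullet> u"
    by transfer (simp add: mult.commute)
  show "(u + v) \<bullet> w = u \<bullet> w + v \<bullet> w"
    by transfer (auto simp: L2_eq_def distrib_right sq_integrable_mult)
  show "(c *\<^sub>R u) \<bullet> v = c * (u \<bullet> v)"
    by transfer (auto simp: mult.assoc)
  show "0 \<le> u \<bullet> u"
    by transfer simp
  show "u \<bullet> u = 0 \<longleftrightarrow> u = 0"
  proof transfer
    fix f :: "real^'a \<Rightarrow> real"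
    assume f: "L2_eq f f"
    then have "((\<integral>x. f x * f x \<partial>lborel) = 0) = (AE x in lborel. f x * f x = 0)"
      by (intro integral_nonneg_eq_0_iff_AE) (auto simp: L2_eq_def sq_integrable_mult)
    with f show "((\<integral>x. f x * f x \<partial>lborel) = 0) = L2_eq f (\<lambda>x. 0)"
      by (auto simp: L2_eq_def sq_integrable_zero)
  qed
  show "norm u = sqrt (u \<bullet> u)" by (simp add: norm_L2_def)
qed

end

text \<open>The quotient package provides \<^term>\<open>rep_L2 u\<close>, some square-integrable representative of
  the class \<^term>\<open>u\<close>. It is only used under integrals, where the choice is irrelevant.\<close>


section \<open>Sobolev spaces\<close>

definition pderiv_at :: "'n::finite \<Rightarrow> (real^'n \<Rightarrow> real) \<Rightarrow> real^'n \<Rightarrow> real" where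
  "pderiv_at j f x = frechet_derivative f (at x) (axis j 1)"

text \<open>Test functions are the compactly supported functions of class $C^1$, as in Gilbarg and
  Trudinger. In all conditions below they can be
  exchanged for $C^\infty_c$ functions, by mollification.\<close>

definition test_function :: "(real^'n::finite \<Rightarrow> real) \<Rightarrow> bool" where
  "test_function \<phi> \<longleftrightarrow>
     (\<forall>x. \<phi> differentiable (at x)) \<and> (\<forall>j. continuous_on UNIV (pderiv_at j \<phi>)) \<and>
     compact (closure {x. \<phi> x \<noteq> 0})"

definition weak_pderiv :: "'n::finite \<Rightarrow> 'n L2 \<Rightarrow> 'n L2 \<Rightarrow> bool" where
  "weak_pderiv j u v \<longleftrightarrow>
     (\<forall>\<phi>. test_function \<phi> \<longrightarrow>
        (\<integral>x. rep_L2 u x * pderiv_at j \<phi> x \<partial>lborel) = - (\<integral>x. rep_L2 v x * \<phi> x \<partial>lborel))"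

definition wderiv :: "'n::finite \<Rightarrow> 'n L2 \<Rightarrow> 'n L2" where
  "wderiv j u = (SOME v. weak_pderiv j u v)"

definition H1 :: "'n::finite L2 set" where
  "H1 = {u. \<forall>j. \<exists>v. weak_pderiv j u v}"

definition H2 :: "'n::finite L2 set" where
  "H2 = {u \<in> H1. \<forall>j. wderiv j u \<in> H1}"

text \<open>The unitary Fourier transform; on square-integrable functions it is characterised by
  $\int \hat u\,\varphi = \int u\,\hat\varphi$ for all test functions $\varphi$.\<close>

definition fourier :: "(real^'n::finite \<Rightarrow> real) \<Rightarrow> real^'n \<Rightarrow> complex" where
  "fourier \<phi> \<xi> =
     of_real ((2 * pi) powr (- real CARD('n) / 2)) *
     (\<integral>x. cis (- (x \<bullet> \<xi>)) * of_real (\<phi> x) \<partial>lborel)"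

definition is_fourier_transform :: "'n::finite L2 \<Rightarrow> (real^'n \<Rightarrow> complex) \<Rightarrow> bool" where
  "is_fourier_transform u w \<longleftrightarrow>
     w \<in> borel_measurable lborel \<and> integrable lborel (\<lambda>\<xi>. (cmod (w \<xi>))\<^sup>2) \<and>
     (\<forall>\<phi>. test_function \<phi> \<longrightarrow>
        (\<integral>\<xi>. w \<xi> * of_real (\<phi> \<xi>) \<partial>lborel) =
        (\<integral>x. of_real (rep_L2 u x) * fourier \<phi> x \<partial>lborel))"

text \<open>The scale $H^\sigma$, $0\le\sigma\le2$: for integer $\sigma$ through weak derivatives,
  otherwise through $\int (1+|\xi|^2)^\sigma |\hat u(\xi)|^2\,d\xi$. The coefficients of the
  integer norms are those of the expansion of $(1+|\xi|^2)^\sigma$, so that by Plancherel's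
  theorem the Fourier formula gives the same norms for $\sigma=0,1,2$.\<close>

definition Hs :: "real \<Rightarrow> 'n::finite L2 set" where
  "Hs \<sigma> = (if \<sigma> = 0 then UNIV else if \<sigma> = 1 then H1 else if \<sigma> = 2 then H2
     else {u. \<exists>w. is_fourier_transform u w \<and>
                  integrable lborel (\<lambda>\<xi>. (1 + (norm \<xi>)\<^sup>2) powr \<sigma> * (cmod (w \<xi>))\<^sup>2)})"

definition Hnorm :: "real \<Rightarrow> 'n::finite L2 \<Rightarrow> real" where
  "Hnorm \<sigma> u =
    (if \<sigma> = 0 then norm u
     else if \<sigma> = 1 then sqrt ((norm u)\<^sup>2 + (\<Sum>j\<in>UNIV. (norm (wderiv j u))\<^sup>2))
     else if \<sigma> = 2 then
       sqrt ((norm u)\<^sup>2 + 2 * (\<Sum>j\<in>UNIV. (norm (wderiv j u))\<^sup>2)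
             + (\<Sum>j\<in>UNIV. \<Sum>k\<in>UNIV. (norm (wderiv k (wderiv j u)))\<^sup>2))
     else sqrt (\<integral>\<xi>. (1 + (norm \<xi>)\<^sup>2) powr \<sigma>
                     * (cmod ((SOME w. is_fourier_transform u w) \<xi>))\<^sup>2 \<partial>lborel))"

definition Hs_continuous_on :: "real \<Rightarrow> real set \<Rightarrow> (real \<Rightarrow> 'n::finite L2) \<Rightarrow> bool" where
  "Hs_continuous_on \<sigma> I u \<longleftrightarrow>
     (\<forall>t\<in>I. u t \<in> Hs \<sigma> \<and> ((\<lambda>p. Hnorm \<sigma> (u p - u t)) \<longlongrightarrow> 0) (at t within I))"


section \<open>The coefficients\<close>

text \<open>\<^term>\<open>a j k t x\<close> stands for $a_{jk}(t,x)$.\<close>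

type_synonym 'n coeff = "'n \<Rightarrow> 'n \<Rightarrow> real \<Rightarrow> real^'n \<Rightarrow> real"

definition symmetric_coeff :: "real \<Rightarrow> 'n::finite coeff \<Rightarrow> bool" where
  "symmetric_coeff T a \<longleftrightarrow> (\<forall>t\<in>{0..T}. \<forall>x j k. a j k t x = a k j t x)"

definition elliptic_coeff :: "real \<Rightarrow> real \<Rightarrow> 'n::finite coeff \<Rightarrow> bool" where
  "elliptic_coeff T \<kappa> a \<longleftrightarrow> 0 < \<kappa> \<and> \<kappa> \<le> 1 \<and>
     (\<forall>t\<in>{0..T}. \<forall>x \<xi>::real^'n.
        \<kappa> * (norm \<xi>)\<^sup>2 \<le> (\<Sum>j\<in>UNIV. \<Sum>k\<in>UNIV. a j k t x * \<xi>$j * \<xi>$k) \<and>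
        (\<Sum>j\<in>UNIV. \<Sum>k\<in>UNIV. a j k t x * \<xi>$j * \<xi>$k) \<le> (1 / \<kappa>) * (norm \<xi>)\<^sup>2)"

definition log_lipschitz_coeff :: "real \<Rightarrow> 'n::finite coeff \<Rightarrow> bool" where
  "log_lipschitz_coeff T a \<longleftrightarrow>
     (\<exists>C. \<forall>j k x. \<forall>t\<in>{0..T}. \<forall>s\<in>{0..T}. 0 < \<bar>t - s\<bar> \<and> \<bar>t - s\<bar> \<le> 1 \<longrightarrow>
        \<bar>a j k t x - a j k s x\<bar> \<le> C * (\<bar>t - s\<bar> * (1 + \<bar>ln \<bar>t - s\<bar>\<bar>)))"

definition bounded_lipschitz_coeff :: "real \<Rightarrow> 'n::finite coeff \<Rightarrow> bool" where
  "bounded_lipschitz_coeff T a \<longleftrightarrow>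
     (\<exists>C. \<forall>j k. \<forall>t\<in>{0..T}. C-lipschitz_on UNIV (a j k t) \<and> (\<forall>x. \<bar>a j k t x\<bar> \<le> C))"

definition standing_hyps :: "real \<Rightarrow> real \<Rightarrow> 'n::finite coeff \<Rightarrow> bool" where
  "standing_hyps T \<kappa> a \<longleftrightarrow>
     symmetric_coeff T a \<and> elliptic_coeff T \<kappa> a \<and>
     log_lipschitz_coeff T a \<and> bounded_lipschitz_coeff T a"

definition A_LL :: "real \<Rightarrow> 'n::finite coeff \<Rightarrow> real" where
  "A_LL T a = Sup {\<bar>a j k t x - a j k s x\<bar> / (\<bar>t - s\<bar> * (1 + \<bar>ln \<bar>t - s\<bar>\<bar>)) | j k t s x.
     t \<in> {0..T} \<and> s \<in> {0..T} \<and> 0 < \<bar>t - s\<bar> \<and> \<bar>t - s\<bar> \<le> 1}"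

definition Linf_norm :: "(real^'n::finite \<Rightarrow> real) \<Rightarrow> real" where
  "Linf_norm f = Inf {c. 0 \<le> c \<and> (AE x in lborel. \<bar>f x\<bar> \<le> c)}"

text \<open>A Lipschitz function is differentiable almost everywhere and its weak derivatives are the
  pointwise ones (Rademacher), hence \<^const>\<open>pderiv_at\<close> below.\<close>

definition A_Lip :: "real \<Rightarrow> 'n::finite coeff \<Rightarrow> real" where
  "A_Lip T a = Sup ({Linf_norm (a j k t) | j k t. t \<in> {0..T}} \<union>
                    {Linf_norm (pderiv_at i (a j k t)) | i j k t. t \<in> {0..T}})"

definition aform :: "'n::finite coeff \<Rightarrow> real \<Rightarrow> 'n L2 \<Rightarrow> 'n L2 \<Rightarrow> real" where
  "aform a t u v =
     (\<integral>x. (\<Sum>j\<in>UNIV. \<Sum>k\<in>UNIV. a j k t x * rep_L2 (wderiv j u) x * rep_L2 (wderiv k v) x) \<partial>lborel)"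


section \<open>Solutions, evolution operators, stability constants\<close>

text \<open>\<^term>\<open>div_form a t u w\<close>: the distribution
  $\sum_{j,k}\partial_{x_j}(a_{jk}(t,\cdot)\,\partial_{x_k}u)$ is the square-integrable
  function \<^term>\<open>w\<close>.\<close>

definition div_form :: "'n::finite coeff \<Rightarrow> real \<Rightarrow> 'n L2 \<Rightarrow> 'n L2 \<Rightarrow> bool" where
  "div_form a t u w \<longleftrightarrow> u \<in> H1 \<and>
     (\<forall>\<phi>. test_function \<phi> \<longrightarrow>
        (\<integral>x. rep_L2 w x * \<phi> x \<partial>lborel) =
        - (\<integral>x. (\<Sum>j\<in>UNIV. \<Sum>k\<in>UNIV. a j k t x * rep_L2 (wderiv k u) x * pderiv_at j \<phi> x) \<partial>lborel))"

definition C1_satisfies_P :: "real \<Rightarrow> real \<Rightarrow> 'n::finite coeff \<Rightarrow> (real \<Rightarrow> 'n L2) \<Rightarrow> bool" where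
  "C1_satisfies_P s T a u \<longleftrightarrow>
     (\<exists>u'. continuous_on {s<..T} u' \<and>
        (\<forall>t\<in>{s<..T}. (u has_vector_derivative u' t) (at t within {s<..T}) \<and>
                      div_form a t (u t) (u' t)))"

text \<open>Solutions of class $C^0([0,T],H^1)\cap C^1(]0,T],L^2)$.\<close>

definition solution_P :: "real \<Rightarrow> 'n::finite coeff \<Rightarrow> (real \<Rightarrow> 'n L2) \<Rightarrow> bool" where
  "solution_P T a u \<longleftrightarrow> Hs_continuous_on 1 {0..T} u \<and> C1_satisfies_P 0 T a u"

text \<open>The time derivative of \<^term>\<open>\<lambda>p. U p s us\<close> is required to be continuous on $]s,T]$,
  so that for \<^term>\<open>us \<in> Hs 1\<close> and \<^term>\<open>s = (0::real)\<close> one obtains a solution in the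
  class above.\<close>

definition evolution_family ::
  "real \<Rightarrow> 'n::finite coeff \<Rightarrow> (real \<Rightarrow> real \<Rightarrow> 'n L2 \<Rightarrow> 'n L2) \<Rightarrow> real \<Rightarrow> bool" where
  "evolution_family T a U M \<longleftrightarrow> 0 < M \<and>
     (\<forall>s p. 0 \<le> s \<and> s \<le> p \<and> p \<le> T \<longrightarrow> bounded_linear (U p s)) \<and>
     (\<forall>s\<in>{0..T}. \<forall>u. U s s u = u) \<and>
     (\<forall>s q p. 0 \<le> s \<and> s \<le> q \<and> q \<le> p \<and> p \<le> T \<longrightarrow> (\<forall>u. U p q (U q s u) = U p s u)) \<and>
     (\<forall>s p \<sigma>. 0 \<le> s \<and> s \<le> p \<and> p \<le> T \<and> 0 \<le> \<sigma> \<and> \<sigma> \<le> 2 \<longrightarrow>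
        (\<forall>u\<in>Hs \<sigma>. U p s u \<in> Hs \<sigma> \<and> Hnorm \<sigma> (U p s u) \<le> M * Hnorm \<sigma> u)) \<and>
     (\<forall>s p \<sigma>1 \<sigma>2. 0 \<le> s \<and> s < p \<and> p \<le> T \<and> 0 \<le> \<sigma>1 \<and> \<sigma>1 < \<sigma>2 \<and> \<sigma>2 \<le> 2 \<longrightarrow>
        (\<forall>u\<in>Hs \<sigma>1. U p s u \<in> Hs \<sigma>2 \<and>
           Hnorm \<sigma>2 (U p s u) \<le> M * (1 + (p - s) powr (- (\<sigma>2 - \<sigma>1))) * Hnorm \<sigma>1 u)) \<and>
     (\<forall>s\<in>{0..T}. \<forall>\<sigma>\<in>{0..2}. \<forall>us\<in>Hs \<sigma>.
        Hs_continuous_on \<sigma> {s..T} (\<lambda>p. U p s us) \<and>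
        Hs_continuous_on 2 {s<..T} (\<lambda>p. U p s us) \<and>
        C1_satisfies_P s T a (\<lambda>p. U p s us))"

definition is_adjoint :: "('n::finite L2 \<Rightarrow> 'n L2) \<Rightarrow> ('n L2 \<Rightarrow> 'n L2) \<Rightarrow> bool" where
  "is_adjoint S S' \<longleftrightarrow> (\<forall>u v. S u \<bullet> v = u \<bullet> S' v)"

definition b_form ::
  "real \<Rightarrow> 'n::finite coeff \<Rightarrow> (real \<Rightarrow> real \<Rightarrow> 'n L2 \<Rightarrow> 'n L2) \<Rightarrow> real \<Rightarrow> 'n L2 \<Rightarrow> 'n L2 \<Rightarrow> real" where
  "b_form T a U \<alpha> u v = \<alpha> * (aform a 0 u v + u \<bullet> v) + U T 0 u \<bullet> U T 0 v"

text \<open>\<^term>\<open>\<rho>\<close>, \<^term>\<open>\<theta>\<close>, \<^term>\<open>K\<close> are constants for which the conditional stability theorem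
  up to $t=0$ holds; they serve all coefficients with the given values of $A_{LL}$ and $A$.
  The estimate is required for all differences at time $T$ up to \<^term>\<open>\<rho>\<close>, and its right-hand
  side is infinite when this difference is 1; hence \<^term>\<open>\<rho> < 1\<close>. For a vanishing difference,
  \<^term>\<open>ln (0::real) = 0\<close> and division by zero yield the limit value 0 of the right-hand side.\<close>

definition stability_constants ::
  "'n::finite itself \<Rightarrow> real \<Rightarrow> real \<Rightarrow> real \<Rightarrow> real \<Rightarrow> real \<Rightarrow> real \<Rightarrow> real \<Rightarrow> real \<Rightarrow> bool" where
  "stability_constants _ a\<^sub>L\<^sub>L a\<^sub>L\<^sub>i\<^sub>p \<kappa> T E \<rho> \<theta> K \<longleftrightarrow> 0 < \<rho> \<and> \<rho> < 1 \<and> 0 < \<theta> \<and> 0 < K \<and>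
     (\<forall>(a :: 'n coeff) u v.
        standing_hyps T \<kappa> a \<and> A_LL T a = a\<^sub>L\<^sub>L \<and> A_Lip T a = a\<^sub>L\<^sub>i\<^sub>p \<and>
        solution_P T a u \<and> solution_P T a v \<and>
        Hnorm 1 (u 0) \<le> E \<and> Hnorm 1 (v 0) \<le> E \<and> norm (u T - v T) \<le> \<rho> \<longrightarrow>
        (SUP t\<in>{0..T}. norm (u t - v t)) \<le> K * (1 / \<bar>ln (norm (u T - v T))\<bar> powr \<theta>))"

end

theory Submission
  imports Defs
begin

text \<open>Testing the equation for $u_{g,\delta}$ with $h = u_{g,\delta} - \bar u(0)$ and polarizing the
  form $[u,v] = a(0;u,v) + \langle u,v\rangle$ gives
  $\alpha[u_{g,\delta},u_{g,\delta}] + \|U(T,0)h\|^2 \le \delta^2 + \alpha[\bar u(0),\bar u(0)]$.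
  For $\alpha = \delta M\kappa$ this bounds $\|u_{g,\delta}\|_{H^1}$ by $(1+E)/\kappa^2$ and
  $\|u(T)-\bar u(T)\|$ by $c\,\delta^{1/2}$ with $c = M^{1/2}(1+E)/\kappa$, so conditional stability
  applies. It gives the rate when $\delta < c^{-4}$. Otherwise $|\log\delta|$ is bounded in terms of
  $c$ alone, and the a priori bound $2M(1+E)/\kappa^2$ suffices; this keeps $K'$ independent of $\rho$.

  That $\bar u(t) = U(t,0)\bar u(0)$ is the energy estimate, which needs an integration by parts for
  functions that are merely in $H^1$. It is obtained without constructing smooth approximations: the
  weak formulation is applied to the translates $\psi(\cdot - z)$ of a bump function, multiplied
  by $w(z)$ and integrated over $z$, so that by Fubini's theorem only the weak convergence of
  mollification in $L^2$ is used.\<close>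

subsection \<open>Bump functions\<close>

text \<open>The evolution operators supply one solution for each initial value, whereas
  \<open>ubar\<close> is merely some solution; without uniqueness the measurement could not be
  related to U(T,0) at all. Uniqueness requires testing the equation for a difference w of two
  solutions with w itself, but \<open>div_form\<close> admits only C^1 test functions of compact
  support. The device that bridges this gap is the double integral of f(x) b(x - z) w(z) with an
  even bump b. Integrated in x first, it tests the equation with a translate of b; integrated in z
  first, it lets the weak derivative of w take over the derivative that fell on b. The regularized
  identity is therefore exact for every b, and only pairings of fixed L2 functions have to pass to
  the limit. Their convergence is a density argument: a bound uniform in the width of b makes the
  set of admissible w closed under L2 limits, and Lipschitz functions of compact support belong to
  it by direct estimate.\<close>

lemma pos_part_sq_deriv:
  "((\<lambda>s::real. (max 0 s)\<^sup>2) has_real_derivative 2 * max 0 s) (at s)"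
proof -
  consider "s > 0" | "s < 0" | "s = 0" by linarith
  then show ?thesis
  proof cases
    case 1
    have "((\<lambda>s::real. s\<^sup>2) has_real_derivative 2 * s) (at s)"
      by (auto intro!: derivative_eq_intros)
    then have "((\<lambda>s::real. (max 0 s)\<^sup>2) has_real_derivative 2 * s) (at s)"
      by (rule has_field_derivative_transform_within_open[where S = "{0<..}"]) (use 1 in auto)
    with 1 show ?thesis by simp
  next
    case 2
    have "((\<lambda>s::real. (0::real)) has_real_derivative 0) (at s)" by simp
    then have "((\<lambda>s::real. (max 0 s)\<^sup>2) has_real_derivative 0) (at s)"
      by (rule has_field_derivative_transform_within_open[where S = "{..<0}"]) (use 2 in auto)
    with 2 show ?thesis by simp
  next
    case 3
    have "((\<lambda>h::real. ((max 0 h)\<^sup>2 - 0) / h) \<longlongrightarrow> 0) (at 0)"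
    proof (rule Lim_null_comparison)
      show "\<forall>\<^sub>F h in at 0. norm (((max 0 h)\<^sup>2 - 0) / h) \<le> \<bar>h::real\<bar>"
        by (rule always_eventually) (auto simp: max_def power2_eq_square)
      show "((\<lambda>h::real. \<bar>h\<bar>) \<longlongrightarrow> 0) (at 0)"
        by (rule tendsto_rabs_zero) simp
    qed
    with 3 show ?thesis by (simp add: DERIV_def)
  qed
qed

text \<open>Test functions need only be C^1, so the squared positive part of a polynomial replaces
  the usual exponential bump. The support is the ball of radius 1/r; the mass is left unnormalized
  and divided out in \<open>mollified_pairing\<close>.\<close>

definition bump :: "real \<Rightarrow> real^'n::finite \<Rightarrow> real" where
  "bump r x = (max 0 (1 - r\<^sup>2 * (x \<bullet> x)))\<^sup>2"

definition bump_deriv :: "real \<Rightarrow> 'n::finite \<Rightarrow> real^'n \<Rightarrow> real" where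
  "bump_deriv r j x = - 4 * r\<^sup>2 * x $ j * max 0 (1 - r\<^sup>2 * (x \<bullet> x))"

lemma bump_nonneg: "0 \<le> bump r x"
  by (simp add: bump_def)

lemma bump_minus: "bump r (- x) = bump r x"
  by (simp add: bump_def)

lemma bump_deriv_minus: "bump_deriv r j (- x) = - bump_deriv r j x"
  by (simp add: bump_deriv_def)

lemma outside_support:
  fixes x :: "real^'n::finite"
  assumes "0 < r" "x \<notin> cball 0 (1 / r)"
  shows "max 0 (1 - r\<^sup>2 * (x \<bullet> x)) = 0"
proof -
  have "1 / r < norm x" using assms by auto
  then have "1 < r * norm x" using assms(1) by (simp add: field_simps)
  then have "1 < (r * norm x)\<^sup>2" by (simp add: one_less_power)
  then show ?thesis by (simp add: power_mult_distrib power2_norm_eq_inner)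
qed

lemma bump_outside: "0 < r \<Longrightarrow> x \<notin> cball 0 (1 / r) \<Longrightarrow> bump r x = 0"
  using outside_support[of r x] by (simp add: bump_def)

lemma bump_deriv_outside: "0 < r \<Longrightarrow> x \<notin> cball 0 (1 / r) \<Longrightarrow> bump_deriv r j x = 0"
  using outside_support[of r x] by (simp add: bump_deriv_def)

lemma continuous_bump: "continuous_on S (bump r)"
  unfolding bump_def by (intro continuous_intros)

lemma continuous_bump_deriv: "continuous_on S (bump_deriv r j)"
  unfolding bump_deriv_def by (intro continuous_intros)

lemma measurable_bump[measurable]: "bump r \<in> borel_measurable borel"
  by (rule borel_measurable_continuous_onI[OF continuous_bump])

lemma measurable_bump_deriv[measurable]: "bump_deriv r j \<in> borel_measurable borel"
  by (rule borel_measurable_continuous_onI[OF continuous_bump_deriv])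

lemma bump_has_derivative:
  fixes x z :: "real^'n::finite"
  shows "((\<lambda>x. bump r (x - z)) has_derivative
     (\<lambda>h. - 4 * r\<^sup>2 * max 0 (1 - r\<^sup>2 * ((x - z) \<bullet> (x - z))) * ((x - z) \<bullet> h))) (at x)"
proof -
  have D: "((\<lambda>x. 1 - r\<^sup>2 * ((x - z) \<bullet> (x - z))) has_derivative
      (\<lambda>h. - (2 * r\<^sup>2 * ((x - z) \<bullet> h)))) (at x)"
    by (auto intro!: derivative_eq_intros simp: inner_commute algebra_simps)
  show ?thesis
    unfolding bump_def
    using pos_part_sq_deriv[THEN DERIV_compose_FDERIV, OF D] by (simp add: algebra_simps)
qed

lemma pderiv_bump: "pderiv_at j (\<lambda>x. bump r (x - z)) x = bump_deriv r j (x - z)"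
  by (simp add: pderiv_at_def frechet_derivative_at[OF bump_has_derivative, symmetric]
      bump_deriv_def inner_axis)

lemma test_function_bump:
  assumes "0 < r"
  shows "test_function (\<lambda>x. bump r (x - z))"
  unfolding test_function_def
proof (intro conjI allI)
  fix x
  show "(\<lambda>x. bump r (x - z)) differentiable at x"
    using bump_has_derivative by (auto simp: differentiable_def)
next
  fix j
  have "continuous_on UNIV (\<lambda>x. bump_deriv r j (x - z))"
    by (rule continuous_on_compose2[OF continuous_bump_deriv[of UNIV]]) (auto intro: continuous_intros)
  then show "continuous_on UNIV (pderiv_at j (\<lambda>x. bump r (x - z)))"
    by (simp add: pderiv_bump[abs_def])
next
  have "{x. bump r (x - z) \<noteq> 0} \<subseteq> cball z (1 / r)"
    using bump_outside[OF assms, of "_ - z"] by (force simp: dist_norm norm_minus_commute)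
  then show "compact (closure {x. bump r (x - z) \<noteq> 0})"
    by (meson bounded_cball bounded_subset compact_closure)
qed

lemma integrable_compact_support:
  fixes f :: "'a::euclidean_space \<Rightarrow> real"
  assumes "continuous_on UNIV f" "compact K" "\<And>x. x \<notin> K \<Longrightarrow> f x = 0"
  shows "integrable lborel f"
proof -
  have "integrable lborel (\<lambda>x. indicator K x *\<^sub>R f x)"
    by (rule borel_integrable_compact) (use assms continuous_on_subset in blast)+
  also have "(\<lambda>x. indicator K x *\<^sub>R f x) = f"
    using assms(3) by (auto simp: fun_eq_iff indicator_def)
  finally show ?thesis .
qed

lemma integrable_bump: "0 < r \<Longrightarrow> integrable lborel (bump r)"
  by (rule integrable_compact_support[OF continuous_bump compact_cball bump_outside])

lemma integrable_bump_deriv: "0 < r \<Longrightarrow> integrable lborel (bump_deriv r j)"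
  by (rule integrable_compact_support[OF continuous_bump_deriv compact_cball bump_deriv_outside])

text \<open>This licenses the later normalization. The bump is positive on an open ball, and a
  nonempty open set is not a null set.\<close>

lemma integral_bump_pos:
  assumes "0 < r"
  shows "0 < (\<integral>x. bump r (x :: real^'n::finite) \<partial>lborel)"
proof (rule ccontr)
  assume "\<not> ?thesis"
  moreover have "0 \<le> (\<integral>x. bump r (x :: real^'n) \<partial>lborel)" by (simp add: bump_nonneg)
  ultimately have "(\<integral>x. bump r (x :: real^'n) \<partial>lborel) = 0" by linarith
  then have ae: "AE x::real^'n in lborel. bump r x = 0"
    using integral_nonneg_eq_0_iff_AE[OF integrable_bump[OF assms]] bump_nonneg
    by auto
  have "bump r x \<noteq> 0" if "x \<in> ball 0 (1 / r)" for x :: "real^'n"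
  proof -
    have "r * norm x < 1" using that assms by (simp add: field_simps)
    then have "(r * norm x)\<^sup>2 < 1" using assms by (simp add: power_less_one_iff abs_square_less_1)
    then show ?thesis by (simp add: bump_def power_mult_distrib power2_norm_eq_inner)
  qed
  with ae have "AE x::real^'n in lborel. x \<notin> ball 0 (1 / r)" by auto
  then have "ball (0::real^'n) (1 / r) \<in> null_sets lborel"
    by (subst AE_iff_null_sets) auto
  then have "negligible (ball (0::real^'n) (1 / r))"
    by (simp add: negligible_iff_null_sets null_sets_completion_iff)
  then show False using open_not_negligible[of "ball (0::real^'n) (1 / r)"] assms by simp
qed

section \<open>Translation invariance and Fubini's theorem for convolution kernels\<close>

lemma
  fixes f :: "'a::euclidean_space \<Rightarrow> real"
  assumes [measurable]: "f \<in> borel_measurable borel"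
  shows integral_translate: "(\<integral>x. f (x - a) \<partial>lborel) = (\<integral>x. f x \<partial>lborel)"
    and integrable_translate: "integrable lborel (\<lambda>x. f (x - a)) \<longleftrightarrow> integrable lborel f"
proof -
  have "(\<integral>x. f x \<partial>lborel) = (\<integral>x. f x \<partial>distr lborel borel ((+) (- a)))"
    by (simp add: lborel_distr_plus)
  also have "\<dots> = (\<integral>x. f (- a + x) \<partial>lborel)"
    by (rule integral_distr) auto
  finally show "(\<integral>x. f (x - a) \<partial>lborel) = (\<integral>x. f x \<partial>lborel)"
    by simp
  have "integrable lborel f \<longleftrightarrow> integrable (distr lborel borel ((+) (- a))) f"
    by (simp add: lborel_distr_plus)
  also have "\<dots> \<longleftrightarrow> integrable lborel (\<lambda>x. f (- a + x))"
    by (rule integrable_distr_eq) auto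
  finally show "integrable lborel (\<lambda>x. f (x - a)) \<longleftrightarrow> integrable lborel f"
    by simp
qed

text \<open>The variable that enters only through k(x - z) is integrated out first and leaves the
  integral of k, by translation invariance. Evenness of k turns the two \<open>snd\<close> claims
  into the \<open>fst\<close> claims with the variables exchanged.\<close>

lemma
  fixes k :: "'a::euclidean_space \<Rightarrow> real"
  assumes k: "integrable lborel k" "\<And>x. 0 \<le> k x" "\<And>x. k (- x) = k x"
    and f: "integrable lborel f" "\<And>x. 0 \<le> f x"
  shows integrable_kernel_fst: "integrable (lborel \<Otimes>\<^sub>M lborel) (\<lambda>(x, z). f x * k (x - z))"
    and integral_kernel_fst: "(\<integral>(x, z). f x * k (x - z) \<partial>(lborel \<Otimes>\<^sub>M lborel)) =
      (\<integral>x. f x \<partial>lborel) * (\<integral>x. k x \<partial>lborel)"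
    and integrable_kernel_snd: "integrable (lborel \<Otimes>\<^sub>M lborel) (\<lambda>(x, z). f z * k (x - z))"
    and integral_kernel_snd: "(\<integral>(x, z). f z * k (x - z) \<partial>(lborel \<Otimes>\<^sub>M lborel)) =
      (\<integral>x. f x \<partial>lborel) * (\<integral>x. k x \<partial>lborel)"
proof -
  have [measurable]: "k \<in> borel_measurable borel" "f \<in> borel_measurable borel"
    using k f by auto
  have flip: "k (x - z) = k (z - x)" for x z using k(3)[of "x - z"] by simp
  have int_k: "integrable lborel (\<lambda>z. k (x - z))" for x
    unfolding flip[of x] using k(1) by (simp add: integrable_translate)
  have integral_k: "(\<integral>z. k (x - z) \<partial>lborel) = (\<integral>z. k z \<partial>lborel)" for x
    unfolding flip[of x] by (simp add: integral_translate)
  show fst_int: "integrable (lborel \<Otimes>\<^sub>M lborel) (\<lambda>(x, z). f x * k (x - z))"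
  proof (rule lborel_pair.Fubini_integrable)
    show "(\<lambda>(x, z). f x * k (x - z)) \<in> borel_measurable (lborel \<Otimes>\<^sub>M lborel)"
      by measurable
    show "integrable lborel (\<lambda>x. \<integral>z. norm (case (x, z) of (x, z) \<Rightarrow> f x * k (x - z)) \<partial>lborel)"
      using k(2) f by (simp add: integral_k)
    show "AE x in lborel. integrable lborel (\<lambda>z. case (x, z) of (x, z) \<Rightarrow> f x * k (x - z))"
      using int_k by simp
  qed
  then show fst_eq: "(\<integral>(x, z). f x * k (x - z) \<partial>(lborel \<Otimes>\<^sub>M lborel)) =
      (\<integral>x. f x \<partial>lborel) * (\<integral>x. k x \<partial>lborel)"
    by (subst lborel_pair.integral_fst[symmetric]) (simp_all add: integral_k)
  have swap: "(\<lambda>(x, z). f z * k (x - z)) = (\<lambda>(x, z). (\<lambda>(x, z). f x * k (x - z)) (z, x))"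
    by (auto simp: fun_eq_iff flip)
  show "integrable (lborel \<Otimes>\<^sub>M lborel) (\<lambda>(x, z). f z * k (x - z))"
    unfolding swap by (rule lborel_pair.integrable_product_swap[OF fst_int])
  show "(\<integral>(x, z). f z * k (x - z) \<partial>(lborel \<Otimes>\<^sub>M lborel)) =
      (\<integral>x. f x \<partial>lborel) * (\<integral>x. k x \<partial>lborel)"
    unfolding swap fst_eq[symmetric]
    by (rule lborel_pair.integral_product_swap) (use fst_int in auto)
qed

subsection \<open>Bilinear forms with a convolution kernel\<close>

text \<open>This is the pairing of f with the convolution of k and w. It is encoded on the product
  space so that either order of integration can be chosen.\<close>

definition kernel_form :: "('a::euclidean_space \<Rightarrow> real) \<Rightarrow> ('a \<Rightarrow> real) \<Rightarrow> ('a \<Rightarrow> real) \<Rightarrow> real" where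
  "kernel_form k f w = (\<integral>(x, z). f x * k (x - z) * w z \<partial>(lborel \<Otimes>\<^sub>M lborel))"

text \<open>A substitute for Young's convolution inequality: |f(x) w(z)| is split by the weighted
  arithmetic-geometric mean inequality, and each square then integrates against |k| separately. The
  free weight s allows the contribution of a fixed f to be made small. Only |k| is assumed even,
  which covers both \<open>bump\<close> and its odd derivative.\<close>

lemma
  fixes k :: "real^'n::finite \<Rightarrow> real"
  assumes k: "integrable lborel k" "\<And>x. \<bar>k (- x)\<bar> = \<bar>k x\<bar>"
    and f: "sq_integrable f" and w: "sq_integrable w"
  shows integrable_kernel: "integrable (lborel \<Otimes>\<^sub>M lborel) (\<lambda>(x, z). f x * k (x - z) * w z)"
    and kernel_form_bound: "0 < s \<Longrightarrow> \<bar>kernel_form k f w\<bar> \<le>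
      (\<integral>x. \<bar>k x\<bar> \<partial>lborel) * (s * (\<integral>x. (f x)\<^sup>2 \<partial>lborel) + (\<integral>x. (w x)\<^sup>2 \<partial>lborel) / s)"
proof -
  have [measurable]: "k \<in> borel_measurable borel" "f \<in> borel_measurable borel" "w \<in> borel_measurable borel"
    using k f w by (auto simp: sq_integrable_def)
  have f2: "integrable lborel (\<lambda>x. (f x)\<^sup>2)" and w2: "integrable lborel (\<lambda>x. (w x)\<^sup>2)"
    using f w by (auto simp: sq_integrable_def)
  note F = integrable_kernel_fst[where k="\<lambda>x. \<bar>k x\<bar>", OF _ _ _ f2]
    integral_kernel_fst[where k="\<lambda>x. \<bar>k x\<bar>", OF _ _ _ f2]
  note W = integrable_kernel_snd[where k="\<lambda>x. \<bar>k x\<bar>", OF _ _ _ w2]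
    integral_kernel_snd[where k="\<lambda>x. \<bar>k x\<bar>", OF _ _ _ w2]
  define G where "G s = (\<lambda>(x, z). s * ((f x)\<^sup>2 * \<bar>k (x - z)\<bar>) + ((w z)\<^sup>2 * \<bar>k (x - z)\<bar>) / s)" for s
  have G_int: "integrable (lborel \<Otimes>\<^sub>M lborel) (G s)" for s
    unfolding G_def case_prod_beta'
    using F(1) W(1) k
    by (intro Bochner_Integration.integrable_add integrable_mult_right integrable_divide)
      (auto simp: case_prod_beta')
  have le: "norm (case p of (x, z) \<Rightarrow> f x * k (x - z) * w z) \<le> G s p" if "0 < s" for p s
  proof -
    obtain x z where p: "p = (x, z)" by (cases p)
    have "0 \<le> (s * \<bar>f x\<bar> - \<bar>w z\<bar>)\<^sup>2" by simp
    then have "2 * s * (\<bar>f x\<bar> * \<bar>w z\<bar>) \<le> s\<^sup>2 * (f x)\<^sup>2 + (w z)\<^sup>2"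
      by (simp add: power2_diff power_mult_distrib algebra_simps)
    then have "2 * (\<bar>f x\<bar> * \<bar>w z\<bar>) \<le> s * (f x)\<^sup>2 + (w z)\<^sup>2 / s"
      using that by (simp add: field_simps power2_eq_square)
    moreover have "0 \<le> \<bar>f x\<bar> * \<bar>w z\<bar>" by simp
    ultimately have "\<bar>f x\<bar> * \<bar>w z\<bar> \<le> s * (f x)\<^sup>2 + (w z)\<^sup>2 / s" by linarith
    from mult_right_mono[OF this, of "\<bar>k (x - z)\<bar>"] show ?thesis
      by (simp add: p G_def abs_mult algebra_simps)
  qed
  show int: "integrable (lborel \<Otimes>\<^sub>M lborel) (\<lambda>(x, z). f x * k (x - z) * w z)"
  proof (rule Bochner_Integration.integrable_bound[OF G_int[of 1]])
    show "(\<lambda>(x, z). f x * k (x - z) * w z) \<in> borel_measurable (lborel \<Otimes>\<^sub>M lborel)" by measurable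
    show "AE p in lborel \<Otimes>\<^sub>M lborel. norm (case p of (x, z) \<Rightarrow> f x * k (x - z) * w z) \<le> norm (G 1 p)"
      by (rule AE_I2, rule order_trans[OF le[of 1]]) auto
  qed
  assume s: "0 < s"
  have "\<bar>kernel_form k f w\<bar> \<le> (\<integral>p. norm (case p of (x, z) \<Rightarrow> f x * k (x - z) * w z) \<partial>(lborel \<Otimes>\<^sub>M lborel))"
    unfolding kernel_form_def real_norm_def[symmetric] by (rule integral_norm_bound)
  also have "\<dots> \<le> (\<integral>p. G s p \<partial>(lborel \<Otimes>\<^sub>M lborel))"
    by (rule integral_mono[OF integrable_norm[OF int] G_int le[OF s]])
  also have "\<dots> = s * (\<integral>(x, z). (f x)\<^sup>2 * \<bar>k (x - z)\<bar> \<partial>(lborel \<Otimes>\<^sub>M lborel)) +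
      (\<integral>(x, z). (w z)\<^sup>2 * \<bar>k (x - z)\<bar> \<partial>(lborel \<Otimes>\<^sub>M lborel)) / s"
    unfolding G_def case_prod_beta'
    using F(1) W(1) k by (subst Bochner_Integration.integral_add)
      (auto simp: case_prod_beta' intro!: integrable_mult_right integrable_divide)
  also have "\<dots> = (\<integral>x. \<bar>k x\<bar> \<partial>lborel) * (s * (\<integral>x. (f x)\<^sup>2 \<partial>lborel) + (\<integral>x. (w x)\<^sup>2 \<partial>lborel) / s)"
    using F(2) W(2) k by (simp add: algebra_simps)
  finally show "\<bar>kernel_form k f w\<bar> \<le> \<dots>" .
qed

section \<open>Criteria for square integrability\<close>

lemma
  assumes "sq_integrable f"
  shows sq_integrable_measurable: "f \<in> borel_measurable borel"
    and sq_integrable_square: "integrable lborel (\<lambda>x. (f x)\<^sup>2)"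
  using assms by (auto simp: sq_integrable_def)

lemma sq_integrable_diff:
  assumes "sq_integrable f" "sq_integrable g"
  shows "sq_integrable (\<lambda>x. f x - g x)"
  using sq_integrable_add[OF assms(1) sq_integrable_scale[OF assms(2), of "-1"]] by simp

lemma sq_integrable_dominated:
  assumes "sq_integrable g" "f \<in> borel_measurable borel" "\<And>x. \<bar>f x\<bar> \<le> \<bar>g x\<bar>"
  shows "sq_integrable f"
  unfolding sq_integrable_def
proof
  show "f \<in> borel_measurable lborel" using assms(2) by simp
  show "integrable lborel (\<lambda>x. (f x)\<^sup>2)"
  proof (rule Bochner_Integration.integrable_bound[OF sq_integrable_square[OF assms(1)]])
    show "(\<lambda>x. (f x)\<^sup>2) \<in> borel_measurable lborel" using assms(2) by measurable
    show "AE x in lborel. norm ((f x)\<^sup>2) \<le> norm ((g x)\<^sup>2)"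
      using assms(3) by (auto intro!: AE_I2 simp: abs_le_square_iff)
  qed
qed

lemma sq_integrable_compact_support:
  assumes "continuous_on UNIV f" "compact K" "\<And>x. x \<notin> K \<Longrightarrow> f x = 0"
  shows "sq_integrable f"
  unfolding sq_integrable_def
proof
  show "f \<in> borel_measurable lborel" using borel_measurable_continuous_onI[OF assms(1)] by simp
  show "integrable lborel (\<lambda>x. (f x)\<^sup>2)"
    by (rule integrable_compact_support[OF _ assms(2)])
      (use assms in \<open>auto intro!: continuous_intros\<close>)
qed

text \<open>With \<open>Suc n\<close> the kernel is never degenerate and its support always lies in
  the unit ball.\<close>

definition mollified_pairing :: "nat \<Rightarrow> (real^'n::finite \<Rightarrow> real) \<Rightarrow> (real^'n \<Rightarrow> real) \<Rightarrow> real" where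
  "mollified_pairing n f w =
     kernel_form (bump (real (Suc n))) f w / (\<integral>x. bump (real (Suc n)) (x :: real^'n) \<partial>lborel)"

text \<open>Weak convergence of the mollifications of w, quantified over all f so that it becomes a
  property of w alone. As such it can be proved by measure-theoretic induction on w.\<close>

definition mollifies :: "(real^'n::finite \<Rightarrow> real) \<Rightarrow> bool" where
  "mollifies w \<longleftrightarrow> (\<forall>f. sq_integrable f \<longrightarrow>
     (\<lambda>n. mollified_pairing n f w) \<longlonglongrightarrow> (\<integral>x. f x * w x \<partial>lborel))"

lemma
  fixes k :: "real^'n::finite \<Rightarrow> real"
  assumes k: "integrable lborel k" "\<And>x. \<bar>k (- x)\<bar> = \<bar>k x\<bar>"
    and f: "sq_integrable f" and w: "sq_integrable w" "sq_integrable v"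
  shows kernel_form_add: "kernel_form k f (\<lambda>x. w x + v x) = kernel_form k f w + kernel_form k f v"
    and kernel_form_diff: "kernel_form k f (\<lambda>x. w x - v x) = kernel_form k f w - kernel_form k f v"
    and kernel_form_scale: "kernel_form k f (\<lambda>x. c * w x) = c * kernel_form k f w"
  using integrable_kernel[OF k f w(1)] integrable_kernel[OF k f w(2)]
  by (simp_all add: kernel_form_def case_prod_beta' distrib_left right_diff_distrib mult.left_commute[of _ c])

lemmas bump_kernel = integrable_bump[of "real (Suc n)"] arg_cong[OF bump_minus, of abs "real (Suc n)"] for n

text \<open>The normalization cancels the mass of the kernel, so the bound does not depend on n.
  This uniformity is what makes \<open>mollifies\<close> stable under L2 limits.\<close>

lemma mollified_pairing_bound:
  fixes f w :: "real^'n::finite \<Rightarrow> real"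
  assumes "sq_integrable f" "sq_integrable w" "0 < s"
  shows "\<bar>mollified_pairing n f w\<bar> \<le> s * (\<integral>x. (f x)\<^sup>2 \<partial>lborel) + (\<integral>x. (w x)\<^sup>2 \<partial>lborel) / s"
proof -
  define c where "c = (\<integral>x. bump (real (Suc n)) (x :: real^'n) \<partial>lborel)"
  have c: "0 < c" unfolding c_def by (rule integral_bump_pos) simp
  have "(\<integral>x. \<bar>bump (real (Suc n)) (x :: real^'n)\<bar> \<partial>lborel) = c"
    by (simp add: c_def bump_nonneg)
  from kernel_form_bound[OF bump_kernel[of n] assms, unfolded this] c show ?thesis
    unfolding mollified_pairing_def c_def[symmetric]
    by (simp add: abs_divide pos_divide_le_eq mult.commute[of c])
qed

lemma mollifies_add:
  assumes "mollifies w" "mollifies v" "sq_integrable w" "sq_integrable v"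
  shows "mollifies (\<lambda>x. w x + v x)"
  unfolding mollifies_def
proof (intro allI impI)
  fix f :: "real^'a \<Rightarrow> real" assume f: "sq_integrable f"
  have "(\<lambda>n. mollified_pairing n f w + mollified_pairing n f v) \<longlonglongrightarrow>
      (\<integral>x. f x * w x \<partial>lborel) + (\<integral>x. f x * v x \<partial>lborel)"
    by (intro tendsto_add) (use assms f in \<open>auto simp: mollifies_def\<close>)
  then show "(\<lambda>n. mollified_pairing n f (\<lambda>x. w x + v x)) \<longlonglongrightarrow> (\<integral>x. f x * (w x + v x) \<partial>lborel)"
    using kernel_form_add[OF bump_kernel f assms(3,4)] sq_integrable_mult[OF f assms(3)]
      sq_integrable_mult[OF f assms(4)]
    by (simp add: mollified_pairing_def add_divide_distrib distrib_left)
qed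

lemma mollifies_scale:
  assumes "mollifies w" "sq_integrable w"
  shows "mollifies (\<lambda>x. c * w x)"
  unfolding mollifies_def
proof (intro allI impI)
  fix f :: "real^'a \<Rightarrow> real" assume f: "sq_integrable f"
  have "(\<lambda>n. c * mollified_pairing n f w) \<longlonglongrightarrow> c * (\<integral>x. f x * w x \<partial>lborel)"
    by (intro tendsto_mult_left) (use assms f in \<open>auto simp: mollifies_def\<close>)
  then show "(\<lambda>n. mollified_pairing n f (\<lambda>x. c * w x)) \<longlonglongrightarrow> (\<integral>x. f x * (c * w x) \<partial>lborel)"
    using kernel_form_scale[OF bump_kernel f assms(2) assms(2)]
    by (simp add: mollified_pairing_def mult.left_commute[of _ c])
qed

lemma mollifies_limit:
  fixes w :: "real^'n::finite \<Rightarrow> real"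
  assumes v: "\<And>i. mollifies (v i)" "\<And>i. sq_integrable (v i)" and w: "sq_integrable w"
    and lim: "(\<lambda>i::nat. \<integral>x. (w x - v i x)\<^sup>2 \<partial>lborel) \<longlonglongrightarrow> 0"
  shows "mollifies w"
  unfolding mollifies_def
proof (intro allI impI LIMSEQ_I)
  fix f :: "real^'n \<Rightarrow> real" and e :: real
  assume f: "sq_integrable f" and e: "0 < e"
  define F where "F = (\<integral>x. (f x)\<^sup>2 \<partial>lborel)"
  have F: "0 \<le> F" by (simp add: F_def)
  \<comment> \<open>This weight keeps the contribution of f at most e/8 for all n, with
    \<open>F + 1\<close> covering F = 0. Once s is fixed, i is taken so large that the contribution
    of \<open>w - v i\<close>, despite the division by s, is below e/8 too.\<close>
  define s where "s = e / (8 * (F + 1))"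
  have s: "0 < s" using e F by (simp add: s_def)
  have sF: "s * F \<le> e / 8"
    using e F by (simp add: s_def field_simps)
  have "0 < s * (e / 8)" using s e by simp
  from LIMSEQ_D[OF lim this] obtain i where "norm ((\<integral>x. (w x - v i x)\<^sup>2 \<partial>lborel) - 0) < s * (e / 8)"
    by blast
  then have i: "(\<integral>x. (w x - v i x)\<^sup>2 \<partial>lborel) / s < e / 8"
    using s by (simp add: field_simps)
  have d: "sq_integrable (\<lambda>x. w x - v i x)" by (rule sq_integrable_diff[OF w v(2)])
  have bound: "s * F + (\<integral>x. (w x - v i x)\<^sup>2 \<partial>lborel) / s < e / 4" using sF i by linarith
  have a: "\<bar>mollified_pairing n f w - mollified_pairing n f (v i)\<bar> < e / 4" for n
  proof -
    have "mollified_pairing n f (\<lambda>x. w x - v i x) = mollified_pairing n f w - mollified_pairing n f (v i)"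
      using kernel_form_diff[OF bump_kernel[of n] f w v(2)[of i]]
      by (simp only: mollified_pairing_def diff_divide_distrib)
    with mollified_pairing_bound[OF f d s, of n] bound show ?thesis
      unfolding F_def by linarith
  qed
  have b: "\<bar>(\<integral>x. f x * w x \<partial>lborel) - (\<integral>x. f x * v i x \<partial>lborel)\<bar> \<le> e / 4"
  proof -
    have "(\<integral>x. f x * w x \<partial>lborel) - (\<integral>x. f x * v i x \<partial>lborel) = (\<integral>x. f x * (w x - v i x) \<partial>lborel)"
      using sq_integrable_mult[OF f w] sq_integrable_mult[OF f v(2), of i]
      by (simp add: right_diff_distrib)
    also have "\<bar>\<dots>\<bar> \<le> (\<integral>x. \<bar>f x * (w x - v i x)\<bar> \<partial>lborel)"
      using integral_norm_bound[of lborel "\<lambda>x. f x * (w x - v i x)"] by simp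
    also have "\<dots> \<le> (\<integral>x. s * (f x)\<^sup>2 + (w x - v i x)\<^sup>2 / s \<partial>lborel)"
    proof (rule integral_mono)
      show "integrable lborel (\<lambda>x. \<bar>f x * (w x - v i x)\<bar>)"
        using sq_integrable_mult[OF f d] by simp
      show "integrable lborel (\<lambda>x. s * (f x)\<^sup>2 + (w x - v i x)\<^sup>2 / s)"
        using sq_integrable_square[OF f] sq_integrable_square[OF d] by simp
      fix x
      have "0 \<le> (s * \<bar>f x\<bar> - \<bar>w x - v i x\<bar>)\<^sup>2" by simp
      then have "2 * s * (\<bar>f x\<bar> * \<bar>w x - v i x\<bar>) \<le> s\<^sup>2 * (f x)\<^sup>2 + (w x - v i x)\<^sup>2"
        unfolding power2_diff[of "s * \<bar>f x\<bar>"] power_mult_distrib power2_abs by (simp add: algebra_simps)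
      then have "2 * (\<bar>f x\<bar> * \<bar>w x - v i x\<bar>) \<le> s * (f x)\<^sup>2 + (w x - v i x)\<^sup>2 / s"
        using s by (simp add: field_simps power2_eq_square[of s])
      moreover have "0 \<le> \<bar>f x\<bar> * \<bar>w x - v i x\<bar>" by simp
      ultimately show "\<bar>f x * (w x - v i x)\<bar> \<le> s * (f x)\<^sup>2 + (w x - v i x)\<^sup>2 / s"
        unfolding abs_mult by linarith
    qed
    also have "\<dots> = s * F + (\<integral>x. (w x - v i x)\<^sup>2 \<partial>lborel) / s"
      using sq_integrable_square[OF f] sq_integrable_square[OF d] by (simp add: F_def)
    finally show ?thesis using bound by linarith
  qed
  have "0 < e / 4" using e by simp
  with v(1)[of i] f obtain N where N: "\<And>n. N \<le> n \<Longrightarrow>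
      norm (mollified_pairing n f (v i) - (\<integral>x. f x * v i x \<partial>lborel)) < e / 4"
    unfolding mollifies_def by (meson LIMSEQ_D)
  show "\<exists>N. \<forall>n\<ge>N. norm (mollified_pairing n f w - (\<integral>x. f x * w x \<partial>lborel)) < e"
  proof (intro exI allI impI)
    fix n assume "N \<le> n"
    from N[OF this] a[of n] b e
    show "norm (mollified_pairing n f w - (\<integral>x. f x * w x \<partial>lborel)) < e"
      unfolding real_norm_def by linarith
  qed
qed

text \<open>Pointwise convergence under a square-integrable majorant h is convergence in L2: the
  squared differences are dominated by 4 h^2.\<close>

lemma mollifies_dominated_limit:
  fixes w :: "real^'n::finite \<Rightarrow> real"
  assumes v: "\<And>i::nat. mollifies (v i)" "\<And>i. v i \<in> borel_measurable borel"
    and w: "sq_integrable w" and h: "sq_integrable h"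
    and dom: "\<And>i x. \<bar>v i x\<bar> \<le> \<bar>h x\<bar>" and lim: "\<And>x. (\<lambda>i. v i x) \<longlonglongrightarrow> w x"
  shows "mollifies w"
proof (rule mollifies_limit[OF v(1) _ w])
  show "sq_integrable (v i)" for i
    by (rule sq_integrable_dominated[OF h v(2) dom])
  have [measurable]: "w \<in> borel_measurable borel" "h \<in> borel_measurable borel"
    using w h by (auto intro: sq_integrable_measurable)
  note v(2)[measurable]
  have wh: "\<bar>w x\<bar> \<le> \<bar>h x\<bar>" for x
    by (rule LIMSEQ_le_const2[OF tendsto_rabs[OF lim]]) (use dom in auto)
  have "(\<lambda>i. \<integral>x. (w x - v i x)\<^sup>2 \<partial>lborel) \<longlonglongrightarrow> (\<integral>x. 0 \<partial>(lborel :: (real^'n) measure))"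
  proof (rule integral_dominated_convergence[where w = "\<lambda>x. 4 * (h x)\<^sup>2"])
    show "integrable lborel (\<lambda>x. 4 * (h x)\<^sup>2)" using sq_integrable_square[OF h] by simp
    show "AE x in lborel. (\<lambda>i. (w x - v i x)\<^sup>2) \<longlonglongrightarrow> 0"
    proof (rule AE_I2)
      fix x
      have "(\<lambda>i. (w x - v i x)\<^sup>2) \<longlonglongrightarrow> (w x - w x)\<^sup>2"
        by (intro tendsto_intros lim)
      then show "(\<lambda>i. (w x - v i x)\<^sup>2) \<longlonglongrightarrow> 0" by simp
    qed
    show "AE x in lborel. norm ((w x - v i x)\<^sup>2) \<le> 4 * (h x)\<^sup>2" for i
    proof (rule AE_I2)
      fix x
      have "\<bar>w x - v i x\<bar> \<le> \<bar>2 * h x\<bar>" using wh[of x] dom[of i x] by linarith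
      then have "(w x - v i x)\<^sup>2 \<le> (2 * h x)\<^sup>2" by (simp add: abs_le_square_iff)
      then show "norm ((w x - v i x)\<^sup>2) \<le> 4 * (h x)\<^sup>2" by (simp add: power_mult_distrib)
    qed
  qed measurable
  then show "(\<lambda>i. \<integral>x. (w x - v i x)\<^sup>2 \<partial>lborel) \<longlonglongrightarrow> 0" by simp
qed

subsection \<open>Convergence of mollified pairings\<close>

lemma sq_integrable_indicator:
  assumes "A \<in> sets borel" "emeasure lborel A < \<infinity>"
  shows "sq_integrable (indicator A)"
proof -
  have "(\<lambda>x. (indicator A x :: real)\<^sup>2) = indicator A" by (auto simp: fun_eq_iff indicator_def)
  with assms show ?thesis by (auto simp: sq_integrable_def)
qed

text \<open>The base case of the density argument. Averaging over a ball of radius 1/r changes a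
  function with Lipschitz constant L by at most L/r, which gives the convergence with the explicit
  rate L Q / (n + 1).\<close>

lemma mollifies_lipschitz:
  fixes g :: "real^'n::finite \<Rightarrow> real"
  assumes lip: "\<And>x y. \<bar>g x - g y\<bar> \<le> L * dist x y" and L: "0 \<le> L" and supp: "\<And>x. x \<notin> cball 0 R \<Longrightarrow> g x = 0"
  shows "sq_integrable g" "mollifies g"
proof -
  have lips: "L-lipschitz_on UNIV g"
    by (rule lipschitz_onI) (use lip L in \<open>auto simp: dist_real_def\<close>)
  have cont: "continuous_on UNIV g"
    by (rule lipschitz_on_continuous_on[OF lips])
  show g: "sq_integrable g"
    by (rule sq_integrable_compact_support[OF cont compact_cball supp])
  have [measurable]: "g \<in> borel_measurable borel" by (rule sq_integrable_measurable[OF g])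
  show "mollifies g"
    unfolding mollifies_def
  proof (intro allI impI)
    fix f :: "real^'n \<Rightarrow> real" assume f: "sq_integrable f"
    have [measurable]: "f \<in> borel_measurable borel" by (rule sq_integrable_measurable[OF f])
    \<comment> \<open>Since 1/r is at most 1, neither g nor its average lives outside the ball of
      radius R + 1. Restricting f to this ball makes it integrable, being a product of two
      square-integrable functions.\<close>
    define I where "I = (indicator (cball 0 (R + 1)) :: real^'n \<Rightarrow> real)"
    have I: "sq_integrable I" unfolding I_def
      by (intro sq_integrable_indicator emeasure_bounded_finite) auto
    have fI: "integrable lborel (\<lambda>x. \<bar>f x\<bar> * I x)"
    proof -
      have "integrable lborel (\<lambda>x. \<bar>f x * I x\<bar>)"
        using sq_integrable_mult[OF f I] by simp
      then show ?thesis by (simp add: abs_mult I_def)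
    qed
    define Q where "Q = (\<integral>x. \<bar>f x\<bar> * I x \<partial>lborel)"
    have main: "\<bar>mollified_pairing n f g - (\<integral>x. f x * g x \<partial>lborel)\<bar> \<le> L * Q * (1 / real (Suc n))" for n
    proof -
      define r where "r = real (Suc n)"
      have r: "0 < r" "1 \<le> r" by (auto simp: r_def)
      define c where "c = (\<integral>x. bump r (x :: real^'n) \<partial>lborel)"
      have c: "0 < c" unfolding c_def by (rule integral_bump_pos[OF r(1)])
      define H where "H x = (\<integral>z. bump r (x - z) * g z \<partial>lborel)" for x
      have flip: "bump r (x - z) = bump r (z - x)" for x z :: "real^'n"
        using bump_minus[of r "x - z"] by simp
      have bi: "integrable lborel (\<lambda>z. bump r (x - z))" for x :: "real^'n"
        unfolding flip[of x] using integrable_bump[OF r(1)] by (simp add: integrable_translate)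
      have bc: "(\<integral>z. bump r (x - z) \<partial>lborel) = c" for x :: "real^'n"
        unfolding flip[of x] c_def by (simp add: integral_translate)
      have bs: "sq_integrable (\<lambda>z. bump r (x - z))" for x :: "real^'n"
      proof (rule sq_integrable_compact_support[where K = "cball x (1 / r)"])
        show "continuous_on UNIV (\<lambda>z. bump r (x - z))"
          by (rule continuous_on_compose2[OF continuous_bump[of UNIV]]) (auto intro: continuous_intros)
        show "bump r (x - z) = 0" if "z \<notin> cball x (1 / r)" for z
          using that by (intro bump_outside r) (simp add: dist_norm norm_minus_commute)
      qed simp
      have bg: "integrable lborel (\<lambda>z. bump r (x - z) * g z)" for x
        by (rule sq_integrable_mult[OF bs g])
      have HI: "\<bar>H x - c * g x\<bar> \<le> c * (L / r) * I x" for x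
      proof -
        have eq: "H x - c * g x = (\<integral>z. bump r (x - z) * (g z - g x) \<partial>lborel)"
          using bg[of x] bi[of x] by (simp add: H_def right_diff_distrib bc)
        have pw: "\<bar>bump r (x - z) * (g z - g x)\<bar> \<le> (L / r) * I x * bump r (x - z)" for z
        proof (cases "x - z \<in> cball 0 (1 / r)")
          case True
          then have d: "dist z x \<le> 1 / r" by (simp add: dist_norm norm_minus_commute)
          have "\<bar>g z - g x\<bar> \<le> (L / r) * I x"
          proof (cases "x \<in> cball 0 (R + 1)")
            case True
            then show ?thesis
              using lip[of z x] mult_left_mono[OF d L] by (simp add: I_def)
          next
            case False
            have "1 / r \<le> 1" using r by simp
            moreover have "norm x \<le> norm z + dist z x"
              by (metis dist_commute dist_norm norm_triangle_sub)
            ultimately have "R < norm z" using d False by simp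
            then have "g z = 0" "g x = 0" using supp False by (auto simp: not_le)
            then show ?thesis using L r by (simp add: I_def)
          qed
          from mult_left_mono[OF this bump_nonneg[of r "x - z"]]
          show ?thesis by (simp add: abs_mult bump_nonneg mult.commute)
        next
          case False
          then show ?thesis using bump_outside[OF r(1) False] by simp
        qed
        have "\<bar>H x - c * g x\<bar> \<le> (\<integral>z. \<bar>bump r (x - z) * (g z - g x)\<bar> \<partial>lborel)"
          unfolding eq using integral_norm_bound[of lborel "\<lambda>z. bump r (x - z) * (g z - g x)"] by simp
        also have "\<dots> \<le> (\<integral>z. (L / r) * I x * bump r (x - z) \<partial>lborel)"
        proof (rule integral_mono[OF _ _ pw])
          have "integrable lborel (\<lambda>z. bump r (x - z) * (g z - g x))"
            using bg[of x] bi[of x] by (simp add: right_diff_distrib)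
          then show "integrable lborel (\<lambda>z. \<bar>bump r (x - z) * (g z - g x)\<bar>)" by simp
        qed (use bi in simp)
        also have "\<dots> = c * (L / r) * I x" by (simp add: bc)
        finally show ?thesis .
      qed
      note K = integrable_kernel[OF bump_kernel[of n] f g, folded r_def]
      have kf: "kernel_form (bump r) f g = (\<integral>x. f x * H x \<partial>lborel)"
        unfolding kernel_form_def H_def lborel_pair.integral_fst[OF K[OF r(1)], symmetric]
        by (simp add: mult.assoc)
      have fH: "integrable lborel (\<lambda>x. f x * H x)"
        using lborel_pair.integrable_fst[OF K[OF r(1)]] by (simp add: H_def mult.assoc)
      have fg: "integrable lborel (\<lambda>x. f x * g x)" by (rule sq_integrable_mult[OF f g])
      have "\<bar>kernel_form (bump r) f g - c * (\<integral>x. f x * g x \<partial>lborel)\<bar> =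
          \<bar>\<integral>x. f x * H x - c * (f x * g x) \<partial>lborel\<bar>"
        unfolding kf using fH fg by simp
      also have "\<dots> \<le> (\<integral>x. \<bar>f x * H x - c * (f x * g x)\<bar> \<partial>lborel)"
        using integral_norm_bound[of lborel "\<lambda>x. f x * H x - c * (f x * g x)"] by simp
      also have "\<dots> \<le> (\<integral>x. c * (L / r) * (\<bar>f x\<bar> * I x) \<partial>lborel)"
      proof (rule integral_mono)
        show "integrable lborel (\<lambda>x. \<bar>f x * H x - c * (f x * g x)\<bar>)" using fH fg by simp
        show "integrable lborel (\<lambda>x. c * (L / r) * (\<bar>f x\<bar> * I x))" using fI by simp
        show "\<bar>f x * H x - c * (f x * g x)\<bar> \<le> c * (L / r) * (\<bar>f x\<bar> * I x)" for x
        proof -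
          have "f x * H x - c * (f x * g x) = f x * (H x - c * g x)" by (simp add: algebra_simps)
          then show ?thesis
            using mult_left_mono[OF HI[of x], of "\<bar>f x\<bar>"] by (simp add: abs_mult mult_ac)
        qed
      qed
      also have "\<dots> = c * (L / r * Q)" by (simp add: Q_def)
      finally have *: "\<bar>kernel_form (bump r) f g - c * (\<integral>x. f x * g x \<partial>lborel)\<bar> \<le> c * (L / r * Q)" .
      have "mollified_pairing n f g - (\<integral>x. f x * g x \<partial>lborel) =
          (kernel_form (bump r) f g - c * (\<integral>x. f x * g x \<partial>lborel)) / c"
        unfolding mollified_pairing_def r_def[symmetric] c_def[symmetric]
        using c by (simp add: field_simps)
      then have "\<bar>mollified_pairing n f g - (\<integral>x. f x * g x \<partial>lborel)\<bar> =
          \<bar>kernel_form (bump r) f g - c * (\<integral>x. f x * g x \<partial>lborel)\<bar> / c"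
        using c by simp
      also have "\<dots> \<le> L / r * Q"
        using * c by (simp add: pos_divide_le_eq mult.commute)
      finally show ?thesis by (simp add: r_def)
    qed
    have "(\<lambda>n. L * Q * (1 / real (Suc n))) \<longlonglongrightarrow> 0"
      using tendsto_mult_right_zero[OF LIMSEQ_inverse_real_of_nat] by (simp add: inverse_eq_divide)
    then have "(\<lambda>n. mollified_pairing n f g - (\<integral>x. f x * g x \<partial>lborel)) \<longlonglongrightarrow> 0"
      by (rule Lim_null_comparison[rotated]) (use main in auto)
    then show "(\<lambda>n. mollified_pairing n f g) \<longlonglongrightarrow> (\<integral>x. f x * g x \<partial>lborel)"
      by (rule LIM_zero_cancel)
  qed
qed

lemma mollifies_indicator_compact:
  fixes K :: "(real^'n::finite) set"
  assumes "compact K"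
  shows "mollifies (indicator K)"
proof (cases "K = {}")
  case True
  then show ?thesis by (simp add: mollifies_def mollified_pairing_def kernel_form_def case_prod_beta')
next
  case False
  obtain B where B: "K \<subseteq> cball 0 B"
    using compact_imp_bounded[OF assms] unfolding bounded_iff by (metis mem_cball_0 subsetI)
  \<comment> \<open>Lipschitz functions that equal 1 on K and decrease to its indicator, because K
    is closed. All vanish at distance 1 or more from K, which yields a common majorant.\<close>
  define g where "g i x = max 0 (1 - real (Suc i) * infdist x K)" for i x
  have lip: "\<bar>g i x - g i y\<bar> \<le> real (Suc i) * dist x y" for i x y
  proof -
    have "\<bar>g i x - g i y\<bar> \<le> real (Suc i) * \<bar>infdist x K - infdist y K\<bar>"
    proof -
      have "\<bar>g i x - g i y\<bar> \<le> \<bar>real (Suc i) * infdist x K - real (Suc i) * infdist y K\<bar>"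
        unfolding g_def by linarith
      also have "\<dots> = real (Suc i) * \<bar>infdist x K - infdist y K\<bar>"
        by (metis abs_mult abs_of_nat right_diff_distrib)
      finally show ?thesis .
    qed
    also have "\<dots> \<le> real (Suc i) * dist x y"
      by (intro mult_left_mono infdist_triangle_abs) simp
    finally show ?thesis .
  qed
  have supp: "g i x = 0" if "x \<notin> cball 0 (B + 1)" for i x
  proof -
    have "1 \<le> infdist x K"
    proof (subst infdist_notempty[OF False], rule cINF_greatest[OF False])
      fix y assume "y \<in> K"
      with B have "norm y \<le> B" by auto
      moreover have "norm x \<le> norm y + dist x y" by (metis dist_norm norm_triangle_sub)
      ultimately show "1 \<le> dist x y" using that by simp
    qed
    then have "1 * 1 \<le> real (Suc i) * infdist x K" by (intro mult_mono) auto
    then show ?thesis by (simp add: g_def)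
  qed
  have g: "sq_integrable (g i)" "mollifies (g i)" for i
    using mollifies_lipschitz[OF lip _ supp] by auto
  show ?thesis
  proof (rule mollifies_dominated_limit[of g _ "indicator (cball 0 (B + 1))"])
    show "g i \<in> borel_measurable borel" for i by (rule sq_integrable_measurable[OF g(1)])
    show "sq_integrable (indicator K)"
      using assms by (intro sq_integrable_indicator emeasure_compact_finite borel_compact)
    show "sq_integrable (indicator (cball 0 (B + 1)))"
      by (intro sq_integrable_indicator emeasure_bounded_finite) auto
    show "\<bar>g i x\<bar> \<le> \<bar>indicator (cball 0 (B + 1)) x\<bar>" for i x
      using supp[of x i] infdist_nonneg[of x K] by (auto simp: g_def indicator_def)
    show "(\<lambda>i. g i x) \<longlonglongrightarrow> indicator K x" for x
    proof (cases "x \<in> K")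
      case True
      then show ?thesis by (simp add: g_def)
    next
      case False
      then have pos: "0 < infdist x K"
        using in_closed_iff_infdist_zero[OF compact_imp_closed[OF assms] \<open>K \<noteq> {}\<close>] infdist_nonneg[of x K]
        by (simp add: order_less_le)
      obtain N where N: "1 < real N * infdist x K" using reals_Archimedean3[OF pos] by blast
      have "g i x = 0" if "N \<le> i" for i
      proof -
        have "real N * infdist x K \<le> real (Suc i) * infdist x K"
          using that pos by (intro mult_right_mono) auto
        then show ?thesis using N by (simp add: g_def)
      qed
      then have "(\<lambda>i. g i x) \<longlonglongrightarrow> 0"
        by (intro tendsto_eventually eventually_sequentiallyI[of N])
      with False show ?thesis by simp
    qed
  qed (rule g)
qed

text \<open>Inner regularity of Lebesgue measure: the squared L2 distance between the indicators of
  A and of a subset K is the measure of A - K. Boundedness of A makes the closed subsets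
  compact.\<close>

lemma mollifies_indicator_bounded:
  fixes A :: "(real^'n::finite) set"
  assumes A: "A \<in> sets borel" "bounded A"
  shows "mollifies (indicator A)"
proof -
  have "\<exists>K. compact K \<and> K \<subseteq> A \<and> emeasure lborel (A - K) < ennreal (1 / real (Suc i))" for i
  proof -
    have "A \<in> sets lebesgue" using A(1) by (metis sets_completionI_sets sets_lborel)
    then obtain T where T: "closed T" "T \<subseteq> A" "A - T \<in> lmeasurable"
        "emeasure lebesgue (A - T) < ennreal (1 / real (Suc i))"
      by (rule sets_lebesgue_inner_closed[where e = "1 / real (Suc i)"]) auto
    have "A - T \<in> sets lborel" using A T by auto
    with T A show ?thesis
      by (intro exI[of _ T]) (auto simp: compact_eq_bounded_closed intro: bounded_subset)
  qed
  then obtain K where K: "\<And>i. compact (K i)" "\<And>i. K i \<subseteq> A"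
    "\<And>i. emeasure lborel (A - K i) < ennreal (1 / real (Suc i))" by metis
  show ?thesis
  proof (rule mollifies_limit[of "\<lambda>i. indicator (K i)"])
    show "mollifies (indicator (K i))" for i by (rule mollifies_indicator_compact[OF K(1)])
    show "sq_integrable (indicator (K i))" for i
      using K by (intro sq_integrable_indicator emeasure_compact_finite borel_compact)
    show "sq_integrable (indicator A)"
      using A by (intro sq_integrable_indicator emeasure_bounded_finite)
    have "(\<integral>x. (indicator A x - indicator (K i) x :: real)\<^sup>2 \<partial>lborel) \<le> 1 / real (Suc i)" for i
    proof -
      have "(\<lambda>x. (indicator A x - indicator (K i) x :: real)\<^sup>2) = indicator (A - K i)"
        using K(2)[of i] by (auto simp: fun_eq_iff indicator_def)
      moreover have "measure lborel (A - K i) \<le> 1 / real (Suc i)"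
        using K(3)[of i] by (simp add: measure_def enn2real_leI less_imp_le)
      ultimately show ?thesis by simp
    qed
    then show "(\<lambda>i. \<integral>x. (indicator A x - indicator (K i) x :: real)\<^sup>2 \<partial>lborel) \<longlonglongrightarrow> 0"
      by (intro Lim_null_comparison[OF _ LIMSEQ_inverse_real_of_nat])
        (auto simp: inverse_eq_divide)
  qed
qed

text \<open>Induction over nonnegative Borel functions. Square integrability travels along as a
  premise on the composed function, so each case has to recover it for the constituents: by dividing
  by the scalar, or by domination, since all functions are nonnegative.\<close>

lemma mollifies_nonneg:
  fixes u :: "real^'n::finite \<Rightarrow> real"
  assumes "u \<in> borel_measurable borel" "\<And>x. 0 \<le> u x" "sq_integrable u"
  shows "mollifies u"
  using assms
proof (induction u rule: borel_measurable_induct_real)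
  case (set A)
  \<comment> \<open>The premise makes A of finite measure but possibly unbounded, hence the
    truncation by growing balls.\<close>
  show ?case
  proof (rule mollifies_dominated_limit[of "\<lambda>i. indicator (A \<inter> cball 0 (real i))" _ "indicator A"])
    show "mollifies (indicator (A \<inter> cball 0 (real i)))" for i
      using set by (intro mollifies_indicator_bounded) auto
    show "(\<lambda>i. indicator (A \<inter> cball 0 (real i)) x) \<longlonglongrightarrow> (indicator A x :: real)" for x
    proof -
      obtain N where N: "norm x \<le> real N" using real_arch_simple by blast
      have "indicator (A \<inter> cball 0 (real i)) x = (indicator A x :: real)" if "N \<le> i" for i
        using that N by (auto simp: indicator_def)
      then show ?thesis by (intro tendsto_eventually eventually_sequentiallyI[of N])
    qed
    show "indicator (A \<inter> cball 0 (real i)) \<in> borel_measurable borel" for i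
      using set by (intro borel_measurable_indicator) auto
    show "\<bar>indicator (A \<inter> cball 0 (real i)) x\<bar> \<le> \<bar>indicator A x :: real\<bar>" for i x
      by (simp add: indicator_def)
  qed (use set in auto)
next
  case (mult u c)
  show ?case
  proof (cases "c = 0")
    case True
    then show ?thesis by (simp add: mollifies_def mollified_pairing_def kernel_form_def case_prod_beta')
  next
    case False
    have "sq_integrable u"
      using sq_integrable_scale[OF mult.prems, of "1 / c"] False by simp
    with mult show ?thesis by (intro mollifies_scale) auto
  qed
next
  case (add u v)
  have "sq_integrable u" "sq_integrable v"
    by (rule sq_integrable_dominated[OF add.prems]; use add in auto)+
  with add show ?case by (intro mollifies_add) auto
next
  case (seq U)
  have inc: "incseq U" and lim: "(\<lambda>i. U i x) \<longlonglongrightarrow> u x" and nonneg: "0 \<le> U i x" for i x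
    using seq by auto
  have "U i x \<le> u x" for i x
    by (rule incseq_le[OF _ lim]) (use inc in \<open>auto simp: incseq_def le_fun_def\<close>)
  then have dom: "\<bar>U i x\<bar> \<le> \<bar>u x\<bar>" for i x
    using nonneg[of i x] by (metis abs_of_nonneg order_trans)
  show ?case
    by (rule mollifies_dominated_limit[OF _ _ seq.prems seq.prems dom])
      (use seq dom sq_integrable_dominated[OF seq.prems _ dom] in auto)
qed

lemma mollifies_sq_integrable:
  fixes u :: "real^'n::finite \<Rightarrow> real"
  assumes u: "sq_integrable u"
  shows "mollifies u"
proof -
  have [measurable]: "u \<in> borel_measurable borel" by (rule sq_integrable_measurable[OF u])
  have p: "sq_integrable (\<lambda>x. max 0 (u x))" "sq_integrable (\<lambda>x. max 0 (- u x))"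
    by (rule sq_integrable_dominated[OF u]; auto)+
  then have "mollifies (\<lambda>x. max 0 (u x))" "mollifies (\<lambda>x. max 0 (- u x))"
    by (auto intro!: mollifies_nonneg)
  then have "mollifies (\<lambda>x. max 0 (u x) + (-1) * max 0 (- u x))"
    using p by (intro mollifies_add mollifies_scale sq_integrable_scale)
  also have "(\<lambda>x. max 0 (u x) + (-1) * max 0 (- u x)) = u" by (auto simp: fun_eq_iff)
  finally show ?thesis .
qed

subsection \<open>Weak derivatives and integration by parts\<close>

lemma rep_sq_integrable: "sq_integrable (rep_L2 u)"
  using Quotient3_rep_reflp[OF Quotient3_L2, of u] by (simp add: L2_eq_def)

lemma rep_abs_AE:
  assumes "sq_integrable f"
  shows "AE x in lborel. rep_L2 (abs_L2 f) x = f x"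
  using Quotient3_rep_abs[OF Quotient3_L2, of f] assms by (simp add: L2_eq_def)

lemma inner_rep: "u \<bullet> v = (\<integral>x. rep_L2 u x * rep_L2 v x \<partial>lborel)"
  by (simp add: inner_L2.rep_eq)

lemma inner_abs:
  assumes "sq_integrable f"
  shows "u \<bullet> abs_L2 f = (\<integral>x. rep_L2 u x * f x \<partial>lborel)"
proof -
  note [measurable] = rep_sq_integrable[THEN sq_integrable_measurable] sq_integrable_measurable[OF assms]
  show ?thesis
    unfolding inner_rep by (rule integral_cong_AE) (use rep_abs_AE[OF assms] in auto)
qed

lemma
  assumes "test_function \<phi>"
  shows test_function_sq_integrable: "sq_integrable \<phi>"
    and pderiv_sq_integrable: "sq_integrable (pderiv_at j \<phi>)"
proof -
  let ?K = "closure {x. \<phi> x \<noteq> 0}"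
  have K: "compact ?K" and diff: "\<And>x. \<phi> differentiable (at x)"
    and cont: "continuous_on UNIV (pderiv_at j \<phi>)"
    using assms by (auto simp: test_function_def)
  have out: "\<phi> x = 0" if "x \<notin> ?K" for x
    using that closure_subset[of "{x. \<phi> x \<noteq> 0}"] by auto
  have "continuous_on UNIV \<phi>"
    using diff by (auto simp: continuous_on_eq_continuous_at intro: differentiable_imp_continuous_within)
  then show "sq_integrable \<phi>"
    by (rule sq_integrable_compact_support[OF _ K out])
  have "pderiv_at j \<phi> x = 0" if "x \<notin> ?K" for x
  proof -
    have "((\<lambda>x. 0) has_derivative (\<lambda>h. 0)) (at x)" by simp
    then have "(\<phi> has_derivative (\<lambda>h. 0)) (at x)"
    proof (rule has_derivative_transform_within_open[where s = "- ?K"])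
      show "open (- ?K)" by (rule open_Compl[OF closed_closure])
      show "x \<in> - ?K" using that by simp
      show "0 = \<phi> y" if "y \<in> - ?K" for y using out[of y] that by simp
    qed
    from frechet_derivative_at[OF this, symmetric] show ?thesis
      by (simp add: pderiv_at_def)
  qed
  then show "sq_integrable (pderiv_at j \<phi>)"
    by (rule sq_integrable_compact_support[OF cont K])
qed

text \<open>The integral condition on chosen representatives becomes an identity between inner
  products, from which linearity is immediate.\<close>

lemma weak_pderiv_inner:
  "weak_pderiv j u v \<longleftrightarrow>
    (\<forall>\<phi>. test_function \<phi> \<longrightarrow> u \<bullet> abs_L2 (pderiv_at j \<phi>) = - (v \<bullet> abs_L2 \<phi>))"
  by (auto simp: weak_pderiv_def inner_abs test_function_sq_integrable pderiv_sq_integrable)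

lemma mollified_pairing_inner:
  "(\<lambda>n. mollified_pairing n (rep_L2 u) (rep_L2 v)) \<longlonglongrightarrow> u \<bullet> v"
  using mollifies_sq_integrable[OF rep_sq_integrable[of v]] rep_sq_integrable[of u]
  by (simp add: mollifies_def inner_rep)

text \<open>The two readings of the double integral. Integrating in x first pairs u with a translate
  of the kernel, to which a weak formulation applies; integrating in z first exposes the convolution
  with v, to which the definition of a weak derivative of v applies.\<close>

lemma
  fixes u v :: "'n::finite L2"
  assumes k: "integrable lborel k" "\<And>x. \<bar>k (- x)\<bar> = \<bar>k x\<bar>"
    and s: "\<And>z. sq_integrable (\<lambda>x. k (x - z))"
  shows kernel_form_snd: "kernel_form k (rep_L2 u) (rep_L2 v) =
      (\<integral>z. (u \<bullet> abs_L2 (\<lambda>x. k (x - z))) * rep_L2 v z \<partial>lborel)"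
    and integrable_kernel_form_snd:
      "integrable lborel (\<lambda>z. (u \<bullet> abs_L2 (\<lambda>x. k (x - z))) * rep_L2 v z)"
    and kernel_form_fst: "kernel_form k (rep_L2 u) (rep_L2 v) =
      (\<integral>x. rep_L2 u x * (\<integral>z. k (x - z) * rep_L2 v z \<partial>lborel) \<partial>lborel)"
proof -
  note K = integrable_kernel[OF k rep_sq_integrable[of u] rep_sq_integrable[of v]]
  have eq: "(\<integral>x. rep_L2 u x * k (x - z) * rep_L2 v z \<partial>lborel) =
      (u \<bullet> abs_L2 (\<lambda>x. k (x - z))) * rep_L2 v z" for z
    by (simp add: inner_abs[OF s])
  show "kernel_form k (rep_L2 u) (rep_L2 v) =
      (\<integral>z. (u \<bullet> abs_L2 (\<lambda>x. k (x - z))) * rep_L2 v z \<partial>lborel)"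
    unfolding kernel_form_def lborel_pair.integral_snd[OF K, symmetric] eq ..
  show "integrable lborel (\<lambda>z. (u \<bullet> abs_L2 (\<lambda>x. k (x - z))) * rep_L2 v z)"
    using lborel_pair.integrable_snd[OF K] by (simp only: eq)
  show "kernel_form k (rep_L2 u) (rep_L2 v) =
      (\<integral>x. rep_L2 u x * (\<integral>z. k (x - z) * rep_L2 v z \<partial>lborel) \<partial>lborel)"
    unfolding kernel_form_def lborel_pair.integral_fst[OF K, symmetric] by (simp add: mult.assoc)
qed

text \<open>Translates of \<open>bump\<close> already suffice as test functions: all mollified
  pairings of v with itself vanish, and they converge to the squared norm of v.\<close>

lemma test_function_dense:
  assumes "\<And>\<phi>. test_function \<phi> \<Longrightarrow> v \<bullet> abs_L2 \<phi> = 0"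
  shows "v = 0"
proof -
  have "mollified_pairing n (rep_L2 v) (rep_L2 v) = 0" for n
  proof -
    have "kernel_form (bump (real (Suc n))) (rep_L2 v) (rep_L2 v) = 0"
      using kernel_form_snd[OF bump_kernel[of n] test_function_sq_integrable[OF test_function_bump],
          where u = v and v = v] assms[OF test_function_bump[of "real (Suc n)"]]
      by (simp del: of_nat_Suc)
    then show ?thesis by (simp add: mollified_pairing_def)
  qed
  with mollified_pairing_inner[of v v] have "v \<bullet> v = 0"
    by (simp add: LIMSEQ_const_iff)
  then show ?thesis by simp
qed

text \<open>Uniqueness of weak derivatives, which turns the choice made in \<open>wderiv\<close>
  into a genuine operation and makes it linear on \<open>H1\<close>.\<close>

lemma wderiv_eq:
  assumes "weak_pderiv j u v"
  shows "wderiv j u = v"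
proof -
  have w: "weak_pderiv j u (wderiv j u)"
    unfolding wderiv_def using assms by (rule someI)
  have "wderiv j u - v = 0"
    by (rule test_function_dense) (use w assms in \<open>auto simp: weak_pderiv_inner inner_diff_left\<close>)
  then show ?thesis by simp
qed

lemma weak_pderiv_wderiv: "u \<in> H1 \<Longrightarrow> weak_pderiv j u (wderiv j u)"
  unfolding H1_def wderiv_def by (auto intro: someI_ex)

lemma weak_pderiv_diff:
  "weak_pderiv j u u' \<Longrightarrow> weak_pderiv j v v' \<Longrightarrow> weak_pderiv j (u - v) (u' - v')"
  by (simp add: weak_pderiv_inner inner_diff_left)

lemma wderiv_diff: "u \<in> H1 \<Longrightarrow> v \<in> H1 \<Longrightarrow> wderiv j (u - v) = wderiv j u - wderiv j v"
  by (intro wderiv_eq weak_pderiv_diff weak_pderiv_wderiv)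

lemma H1_diff: "u \<in> H1 \<Longrightarrow> v \<in> H1 \<Longrightarrow> u - v \<in> H1"
  unfolding H1_def by (blast intro: weak_pderiv_diff)

text \<open>The hypothesis says that w' is the distributional divergence of the field F; the claim
  extends its test functions to all of \<open>H1\<close>. Both sides, mollified with the same bump,
  agree for every n, and each pairing converges.\<close>

lemma integration_by_parts:
  fixes w w' :: "'n::finite L2" and F :: "'n \<Rightarrow> 'n L2"
  assumes div: "\<And>\<phi>. test_function \<phi> \<Longrightarrow>
      w' \<bullet> abs_L2 \<phi> = - (\<Sum>j\<in>UNIV. F j \<bullet> abs_L2 (pderiv_at j \<phi>))"
    and w: "w \<in> H1"
  shows "w' \<bullet> w = - (\<Sum>j\<in>UNIV. F j \<bullet> wderiv j w)"
proof -
  have eq: "mollified_pairing n (rep_L2 w') (rep_L2 w) =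
      - (\<Sum>j\<in>UNIV. mollified_pairing n (rep_L2 (F j)) (rep_L2 (wderiv j w)))" for n
  proof -
    define r where "r = real (Suc n)"
    have r: "0 < r" by (simp add: r_def)
    let ?b = "bump r :: real^'n \<Rightarrow> real"
    let ?d = "\<lambda>j. bump_deriv r j :: real^'n \<Rightarrow> real"
    note b = integrable_bump[OF r] arg_cong[OF bump_minus, of abs r]
    have d: "integrable lborel (?d j)" "\<bar>?d j (- x)\<bar> = \<bar>?d j x\<bar>" for j x
      using integrable_bump_deriv[OF r] by (auto simp: bump_deriv_minus)
    have sb: "sq_integrable (\<lambda>x. ?b (x - z))" for z
      by (rule test_function_sq_integrable[OF test_function_bump[OF r]])
    have sd: "sq_integrable (\<lambda>x. ?d j (x - z))" for j z
      using pderiv_sq_integrable[OF test_function_bump[OF r]] by (simp add: pderiv_bump[abs_def])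
    have "kernel_form ?b (rep_L2 w') (rep_L2 w) =
        (\<integral>z. (w' \<bullet> abs_L2 (\<lambda>x. ?b (x - z))) * rep_L2 w z \<partial>lborel)"
      by (rule kernel_form_snd[OF b sb])
    also have "\<dots> = (\<integral>z. - (\<Sum>j\<in>UNIV. (F j \<bullet> abs_L2 (\<lambda>x. ?d j (x - z))) * rep_L2 w z) \<partial>lborel)"
      by (simp add: div[OF test_function_bump[OF r]] pderiv_bump[abs_def] sum_distrib_right)
    also have "\<dots> = - (\<Sum>j\<in>UNIV. \<integral>z. (F j \<bullet> abs_L2 (\<lambda>x. ?d j (x - z))) * rep_L2 w z \<partial>lborel)"
      using integrable_kernel_form_snd[OF d sd] by simp
    also have "\<dots> = - (\<Sum>j\<in>UNIV. kernel_form (?d j) (rep_L2 (F j)) (rep_L2 w))"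
      by (simp add: kernel_form_snd[OF d sd])
    also have "\<dots> = - (\<Sum>j\<in>UNIV. kernel_form ?b (rep_L2 (F j)) (rep_L2 (wderiv j w)))"
    proof -
      have "(\<integral>z. ?d j (x - z) * rep_L2 w z \<partial>lborel) = (\<integral>z. ?b (x - z) * rep_L2 (wderiv j w) z \<partial>lborel)" for j x
      proof -
        \<comment> \<open>The derivative kernel is odd, and the weak derivative in the variable z
          contributes another minus sign; the two cancel.\<close>
        have flip: "?d j (x - z) = - ?d j (z - x)" "?b (x - z) = ?b (z - x)" for z
          using bump_deriv_minus[of r j "z - x"] bump_minus[of r "z - x"] by auto
        have "(\<integral>z. rep_L2 w z * ?d j (z - x) \<partial>lborel) = - (\<integral>z. rep_L2 (wderiv j w) z * ?b (z - x) \<partial>lborel)"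
          using weak_pderiv_wderiv[OF w, of j] test_function_bump[OF r, of x]
          unfolding weak_pderiv_def by (auto simp: pderiv_bump[abs_def])
        then show ?thesis by (simp add: flip mult.commute)
      qed
      then show ?thesis
        by (simp add: kernel_form_fst[OF d sd] kernel_form_fst[OF b sb])
    qed
    finally show ?thesis
      unfolding mollified_pairing_def r_def[symmetric]
      by (simp add: sum_divide_distrib)
  qed
  have "(\<lambda>n. mollified_pairing n (rep_L2 w') (rep_L2 w)) \<longlonglongrightarrow> - (\<Sum>j\<in>UNIV. F j \<bullet> wderiv j w)"
    unfolding eq by (intro tendsto_minus tendsto_sum mollified_pairing_inner)
  with mollified_pairing_inner show ?thesis by (rule LIMSEQ_unique)
qed

section \<open>Multiplication of L2 classes by bounded coefficients\<close>

definition bounded_measurable :: "(real^'n::finite \<Rightarrow> real) \<Rightarrow> bool" where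
  "bounded_measurable b \<longleftrightarrow> b \<in> borel_measurable borel \<and> (\<exists>C. \<forall>x. \<bar>b x\<bar> \<le> C)"

lemma sq_integrable_bounded_mult:
  assumes "bounded_measurable b" "sq_integrable f"
  shows "sq_integrable (\<lambda>x. b x * f x)"
proof -
  obtain C where C: "\<And>x. \<bar>b x\<bar> \<le> C" and [measurable]: "b \<in> borel_measurable borel"
    using assms(1) by (auto simp: bounded_measurable_def)
  have [measurable]: "f \<in> borel_measurable borel" by (rule sq_integrable_measurable[OF assms(2)])
  show ?thesis
  proof (rule sq_integrable_dominated[OF sq_integrable_scale[OF assms(2), of C]])
    have "0 \<le> C" using C[of 0] by (meson abs_ge_zero order_trans)
    then show "\<bar>b x * f x\<bar> \<le> \<bar>C * f x\<bar>" for x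
      unfolding abs_mult using C[of x] by (intro mult_right_mono) auto
  qed measurable
qed

lemma sq_integrable_if_mult:
  assumes "sq_integrable f"
  shows "sq_integrable (\<lambda>x. if bounded_measurable b then b x * f x else 0)"
  using sq_integrable_bounded_mult[OF _ assms, of b] sq_integrable_zero
  by (cases "bounded_measurable b") auto

text \<open>The lifted function must respect the equivalence for every b, and an arbitrary b could
  lead out of L2; hence the value 0 for coefficients that are not bounded and measurable.\<close>

lift_definition mult_L2 :: "(real^'n::finite \<Rightarrow> real) \<Rightarrow> 'n L2 \<Rightarrow> 'n L2"
  is "\<lambda>b f x. if bounded_measurable b then b x * f x else 0"
  by (auto simp: L2_eq_def intro: sq_integrable_if_mult)

lemma mult_L2_add: "mult_L2 b (u + v) = mult_L2 b u + mult_L2 b v"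
  by transfer (auto simp: L2_eq_def distrib_left
      intro!: sq_integrable_if_mult sq_integrable_add)

lemma mult_L2_diff: "mult_L2 b (u - v) = mult_L2 b u - mult_L2 b v"
  using mult_L2_add[of b "u - v" v] by (simp add: algebra_simps)

lemma mult_L2_inner:
  assumes "bounded_measurable b"
  shows "mult_L2 b u \<bullet> v = (\<integral>x. b x * rep_L2 u x * rep_L2 v x \<partial>lborel)"
proof -
  have "mult_L2 b u = abs_L2 (\<lambda>x. b x * rep_L2 u x)"
    using assms by (simp add: mult_L2_def)
  then show ?thesis
    using inner_abs[OF sq_integrable_bounded_mult[OF assms rep_sq_integrable], of v u]
    by (simp add: inner_commute mult_ac)
qed

lemma mult_L2_inner_commute:
  "bounded_measurable b \<Longrightarrow> mult_L2 b u \<bullet> v = mult_L2 b v \<bullet> u"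
  by (simp add: mult_L2_inner mult_ac)

subsection \<open>The energy estimate\<close>

lemma standing_hyps_bounded_measurable:
  assumes "standing_hyps T \<kappa> a" "t \<in> {0..T}"
  shows "bounded_measurable (a j k t)"
proof -
  obtain C where "C-lipschitz_on UNIV (a j k t)" "\<And>x. \<bar>a j k t x\<bar> \<le> C"
    using assms unfolding standing_hyps_def bounded_lipschitz_coeff_def by blast
  then show ?thesis
    unfolding bounded_measurable_def
    by (blast intro: borel_measurable_continuous_onI lipschitz_on_continuous_on)
qed

text \<open>In this form the linearity of the inner product carries over to \<open>aform\<close>,
  without handling representatives again.\<close>

lemma aform_inner:
  assumes "\<And>j k. bounded_measurable (a j k t)"
  shows "aform a t u v = (\<Sum>j\<in>UNIV. \<Sum>k\<in>UNIV. mult_L2 (a j k t) (wderiv j u) \<bullet> wderiv k v)"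
  using sq_integrable_mult[OF sq_integrable_bounded_mult[OF assms rep_sq_integrable] rep_sq_integrable]
  by (simp add: aform_def mult_L2_inner[OF assms])

lemma aform_diff_right:
  assumes "\<And>j k. bounded_measurable (a j k t)" "v \<in> H1" "w \<in> H1"
  shows "aform a t u (v - w) = aform a t u v - aform a t u w"
  using assms by (simp add: aform_inner wderiv_diff inner_diff_right sum_subtractf)

section \<open>Symmetry and ellipticity of the form\<close>

lemma standing_hyps_symmetric:
  "standing_hyps T \<kappa> a \<Longrightarrow> t \<in> {0..T} \<Longrightarrow> a j k t = a k j t"
  by (auto simp: standing_hyps_def symmetric_coeff_def fun_eq_iff)

lemma aform_commute:
  assumes "standing_hyps T \<kappa> a" "t \<in> {0..T}"
  shows "aform a t u v = aform a t v u"
proof -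
  note bm = standing_hyps_bounded_measurable[OF assms]
  have "aform a t u v = (\<Sum>k\<in>UNIV. \<Sum>j\<in>UNIV. mult_L2 (a j k t) (wderiv j u) \<bullet> wderiv k v)"
    unfolding aform_inner[of a t, OF bm] by (rule sum.swap)
  also have "\<dots> = aform a t v u"
    unfolding aform_inner[of a t, OF bm] 
    by (intro sum.cong refl) (metis mult_L2_inner_commute[OF bm] standing_hyps_symmetric[OF assms])
  finally show ?thesis .
qed

text \<open>Ellipticity is applied at each point to the vector of values of the weak gradient and
  then integrated.\<close>

lemma
  assumes "standing_hyps T \<kappa> a" "t \<in> {0..T}"
  shows aform_lower: "\<kappa> * (\<Sum>j\<in>UNIV. (norm (wderiv j u))\<^sup>2) \<le> aform a t u u"
    and aform_upper: "aform a t u u \<le> (1 / \<kappa>) * (\<Sum>j\<in>UNIV. (norm (wderiv j u))\<^sup>2)"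
proof -
  note bm = standing_hyps_bounded_measurable[OF assms]
  define q where "q x = (\<Sum>j\<in>UNIV. \<Sum>k\<in>UNIV. a j k t x * rep_L2 (wderiv j u) x * rep_L2 (wderiv k u) x)" for x
  define p where "p x = (\<Sum>j\<in>UNIV. (rep_L2 (wderiv j u) x)\<^sup>2)" for x
  have q: "integrable lborel q"
    unfolding q_def
    using sq_integrable_mult[OF sq_integrable_bounded_mult[OF bm rep_sq_integrable] rep_sq_integrable]
    by simp
  have p: "integrable lborel p"
    unfolding p_def by (intro Bochner_Integration.integrable_sum sq_integrable_square rep_sq_integrable)
  have int_p: "(\<integral>x. p x \<partial>lborel) = (\<Sum>j\<in>UNIV. (norm (wderiv j u))\<^sup>2)"
  proof -
    have "(norm v)\<^sup>2 = (\<integral>x. (rep_L2 v x)\<^sup>2 \<partial>lborel)" for v :: "'a L2"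
      unfolding power2_norm_eq_inner inner_rep by (simp only: power2_eq_square)
    then show ?thesis
      unfolding p_def by (simp add: Bochner_Integration.integral_sum[OF sq_integrable_square[OF rep_sq_integrable]])
  qed
  have bounds: "\<kappa> * p x \<le> q x \<and> q x \<le> (1 / \<kappa>) * p x" for x
  proof -
    define \<xi> where "\<xi> = (\<chi> j. rep_L2 (wderiv j u) x)"
    have "(norm \<xi>)\<^sup>2 = p x"
      unfolding p_def \<xi>_def power2_norm_eq_inner inner_vec_def by (simp add: power2_eq_square)
    moreover have "\<kappa> * (norm \<xi>)\<^sup>2 \<le> (\<Sum>j\<in>UNIV. \<Sum>k\<in>UNIV. a j k t x * \<xi>$j * \<xi>$k) \<and>
        (\<Sum>j\<in>UNIV. \<Sum>k\<in>UNIV. a j k t x * \<xi>$j * \<xi>$k) \<le> (1 / \<kappa>) * (norm \<xi>)\<^sup>2"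
      using assms unfolding standing_hyps_def elliptic_coeff_def by blast
    ultimately show ?thesis by (simp add: q_def \<xi>_def)
  qed
  have a: "aform a t u u = (\<integral>x. q x \<partial>lborel)" by (simp add: aform_def q_def)
  have "(\<integral>x. \<kappa> * p x \<partial>lborel) \<le> (\<integral>x. q x \<partial>lborel)"
    by (rule integral_mono) (use p q bounds in auto)
  then show "\<kappa> * (\<Sum>j\<in>UNIV. (norm (wderiv j u))\<^sup>2) \<le> aform a t u u"
    by (simp add: a int_p)
  have "(\<integral>x. q x \<partial>lborel) \<le> (\<integral>x. (1 / \<kappa>) * p x \<partial>lborel)"
    by (rule integral_mono) (use p q bounds in auto)
  then show "aform a t u u \<le> (1 / \<kappa>) * (\<Sum>j\<in>UNIV. (norm (wderiv j u))\<^sup>2)"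
    by (simp add: a int_p)
qed

text \<open>With the flux collected into L2 classes, one for each j, the equation takes exactly the
  shape of the hypothesis \<open>div\<close> of \<open>integration_by_parts\<close>.\<close>

lemma div_form_inner:
  assumes bm: "\<And>j k. bounded_measurable (a j k t)"
  shows "div_form a t u w \<longleftrightarrow> u \<in> H1 \<and> (\<forall>\<phi>. test_function \<phi> \<longrightarrow>
    w \<bullet> abs_L2 \<phi> = - (\<Sum>j\<in>UNIV. (\<Sum>k\<in>UNIV. mult_L2 (a j k t) (wderiv k u)) \<bullet> abs_L2 (pderiv_at j \<phi>)))"
proof -
  have "(\<integral>x. (\<Sum>j\<in>UNIV. \<Sum>k\<in>UNIV. a j k t x * rep_L2 (wderiv k u) x * pderiv_at j \<phi> x) \<partial>lborel) =
      (\<Sum>j\<in>UNIV. (\<Sum>k\<in>UNIV. mult_L2 (a j k t) (wderiv k u)) \<bullet> abs_L2 (pderiv_at j \<phi>))"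
    if \<phi>: "test_function \<phi>" for \<phi>
  proof -
    note sp = pderiv_sq_integrable[OF \<phi>]
    have eq: "mult_L2 (a j k t) v \<bullet> abs_L2 (pderiv_at j \<phi>) =
        (\<integral>x. a j k t x * rep_L2 v x * pderiv_at j \<phi> x \<partial>lborel)" for j k v
    proof -
      have "mult_L2 (a j k t) v \<bullet> abs_L2 (pderiv_at j \<phi>) =
          (\<integral>x. a j k t x * rep_L2 v x * rep_L2 (abs_L2 (pderiv_at j \<phi>)) x \<partial>lborel)"
        by (rule mult_L2_inner[OF bm])
      also have "\<dots> = (\<integral>x. a j k t x * rep_L2 v x * pderiv_at j \<phi> x \<partial>lborel)"
      proof (rule integral_cong_AE)
        note [measurable] = rep_sq_integrable[THEN sq_integrable_measurable]
          sq_integrable_measurable[OF sp] bm[unfolded bounded_measurable_def, THEN conjunct1]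
        show "(\<lambda>x. a j k t x * rep_L2 v x * rep_L2 (abs_L2 (pderiv_at j \<phi>)) x) \<in> borel_measurable lborel"
          "(\<lambda>x. a j k t x * rep_L2 v x * pderiv_at j \<phi> x) \<in> borel_measurable lborel"
          by measurable
      qed (use rep_abs_AE[OF sp[of j]] in auto)
      finally show ?thesis .
    qed
    show ?thesis
      using sq_integrable_mult[OF sq_integrable_bounded_mult[OF bm rep_sq_integrable] sp]
      by (simp add: inner_sum_left eq)
  qed
  then show ?thesis
    by (auto simp: div_form_def inner_abs test_function_sq_integrable)
qed

text \<open>Monotonicity of the elliptic operator: the difference w of the two functions is itself
  an admissible test function by \<open>integration_by_parts\<close>, and the pairing equals
  -a(t;w,w).\<close>

lemma div_form_energy:
  assumes "standing_hyps T \<kappa> a" "t \<in> {0..T}" "div_form a t u u'" "div_form a t v v'"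
  shows "(u' - v') \<bullet> (u - v) \<le> 0"
proof -
  note bm = standing_hyps_bounded_measurable[OF assms(1,2)]
  let ?w = "u - v"
  let ?F = "\<lambda>j. \<Sum>k\<in>UNIV. mult_L2 (a j k t) (wderiv k ?w)"
  have H: "u \<in> H1" "v \<in> H1" using assms(3,4) by (auto simp: div_form_def)
  have "(u' - v') \<bullet> ?w = - (\<Sum>j\<in>UNIV. ?F j \<bullet> wderiv j ?w)"
  proof (rule integration_by_parts)
    fix \<phi> :: "real^'a \<Rightarrow> real" assume "test_function \<phi>"
    then show "(u' - v') \<bullet> abs_L2 \<phi> = - (\<Sum>j\<in>UNIV. ?F j \<bullet> abs_L2 (pderiv_at j \<phi>))"
      using assms(3,4)
      by (simp add: div_form_inner[of a t, OF bm] wderiv_diff H mult_L2_diff sum_subtractf inner_diff_left)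
  qed (rule H1_diff[OF H])
  also have "(\<Sum>j\<in>UNIV. ?F j \<bullet> wderiv j ?w) = aform a t ?w ?w"
    unfolding aform_inner[of a t, OF bm] inner_sum_left
    by (intro sum.cong refl) (rule mult_L2_inner_commute[OF bm])
  finally have "(u' - v') \<bullet> ?w = - aform a t ?w ?w" .
  moreover have "0 < \<kappa>" using assms(1) by (simp add: standing_hyps_def elliptic_coeff_def)
  then have "0 \<le> \<kappa> * (\<Sum>j\<in>UNIV. (norm (wderiv j ?w))\<^sup>2)" by (simp add: sum_nonneg)
  ultimately show ?thesis using aform_lower[OF assms(1,2), of ?w] by linarith
qed

section \<open>From the energy inequality to uniqueness of solutions\<close>

lemma norm_le_Hnorm1: "norm u \<le> Hnorm 1 u"
  unfolding Hnorm_def by (auto intro!: real_le_rsqrt sum_nonneg)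

lemma Hs_1: "Hs 1 = H1"
  by (simp add: Hs_def)

lemma solution_continuous:
  assumes "Hs_continuous_on 1 S u"
  shows "continuous_on S u"
  unfolding continuous_on_def
proof
  fix t assume "t \<in> S"
  then have "((\<lambda>p. Hnorm 1 (u p - u t)) \<longlongrightarrow> 0) (at t within S)"
    using assms by (auto simp: Hs_continuous_on_def)
  then have "((\<lambda>p. u p - u t) \<longlongrightarrow> 0) (at t within S)"
    by (rule Lim_null_comparison[rotated]) (simp add: norm_le_Hnorm1)
  then show "(u \<longlongrightarrow> u t) (at t within S)" by (rule LIM_zero_cancel)
qed

text \<open>The squared L2 norm of the difference is nonincreasing and starts at 0. The equation is
  available only for positive times, so at time 0 the argument relies on continuity.\<close>

lemma solution_unique:
  assumes hyps: "standing_hyps T \<kappa> a"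
    and u: "solution_P T a u" and v: "solution_P T a v" and init: "u 0 = v 0" and t: "t \<in> {0..T}"
  shows "u t = v t"
proof -
  obtain u' where u': "\<And>s. s \<in> {0<..T} \<Longrightarrow> (u has_vector_derivative u' s) (at s within {0<..T})"
      "\<And>s. s \<in> {0<..T} \<Longrightarrow> div_form a s (u s) (u' s)"
    using u unfolding solution_P_def C1_satisfies_P_def by blast
  obtain v' where v': "\<And>s. s \<in> {0<..T} \<Longrightarrow> (v has_vector_derivative v' s) (at s within {0<..T})"
      "\<And>s. s \<in> {0<..T} \<Longrightarrow> div_form a s (v s) (v' s)"
    using v unfolding solution_P_def C1_satisfies_P_def by blast
  define E where "E s = (u s - v s) \<bullet> (u s - v s)" for s
  have "continuous_on {0..T} u" "continuous_on {0..T} v"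
    using u v by (auto simp: solution_P_def intro: solution_continuous)
  then have cont: "continuous_on {0..t} E"
    unfolding E_def using t
    by (auto intro!: continuous_intros intro: continuous_on_subset)
  have "E t \<le> E 0"
  proof (rule DERIV_nonpos_imp_decreasing_open[OF _ _ cont])
    fix s assume s: "0 < s" "s < t"
    then have sT: "s \<in> {0<..T}" "s \<in> {0..T}" "s \<in> {0<..<T}" using t by auto
    \<comment> \<open>One-sided derivatives occur in the definition only at T; here s < t \<le> T,
      so the derivative is two-sided.\<close>
    have at: "at s within {0<..T} = at s"
      by (rule at_within_open_subset[of _ "{0<..<T}"]) (use sT in auto)
    have "((\<lambda>s. u s - v s) has_vector_derivative (u' s - v' s)) (at s)"
      using u'(1)[OF sT(1)] v'(1)[OF sT(1)] unfolding at by (rule has_vector_derivative_diff)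
    from bounded_bilinear.has_vector_derivative[OF bounded_bilinear_inner this this]
    have "(E has_real_derivative 2 * ((u' s - v' s) \<bullet> (u s - v s))) (at s)"
      unfolding has_real_derivative_iff_has_vector_derivative E_def
      by (simp add: inner_commute)
    moreover have "(u' s - v' s) \<bullet> (u s - v s) \<le> 0"
      by (rule div_form_energy[OF hyps sT(2) u'(2)[OF sT(1)] v'(2)[OF sT(1)]])
    ultimately show "\<exists>y. (E has_real_derivative y) (at s) \<and> y \<le> 0" by fastforce
  qed (use t in auto)
  also have "E 0 = 0" by (simp add: E_def init)
  finally have "(u t - v t) \<bullet> (u t - v t) = 0"
    using inner_ge_zero[of "u t - v t"] unfolding E_def by linarith
  then show ?thesis by simp
qed

subsection \<open>The regularized problem\<close>

text \<open>The bracket [u,v] of the overview; on the diagonal it is comparable to the squared H^1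
  norm, with constants \<kappa> and 1/\<kappa>.\<close>

definition graph_form :: "'n::finite coeff \<Rightarrow> 'n L2 \<Rightarrow> 'n L2 \<Rightarrow> real" where
  "graph_form a u v = aform a 0 u v + u \<bullet> v"

lemma Hnorm1_square: "(Hnorm 1 u)\<^sup>2 = (norm u)\<^sup>2 + (\<Sum>j\<in>UNIV. (norm (wderiv j u))\<^sup>2)"
  unfolding Hnorm_def by (simp add: sum_nonneg add_nonneg_nonneg)

lemma
  assumes "standing_hyps T \<kappa> a" "0 \<le> T"
  shows graph_form_lower: "\<kappa> * (Hnorm 1 u)\<^sup>2 \<le> graph_form a u u"
    and graph_form_upper: "graph_form a u u \<le> (1 / \<kappa>) * (Hnorm 1 u)\<^sup>2"
proof -
  have k: "0 < \<kappa>" "\<kappa> \<le> 1" using assms(1) by (auto simp: standing_hyps_def elliptic_coeff_def)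
  have 0: "0 \<in> {0..T}" using assms(2) by simp
  have "\<kappa> * (norm u)\<^sup>2 \<le> 1 * (norm u)\<^sup>2" using k by (intro mult_right_mono) auto
  with aform_lower[OF assms(1) 0, of u]
  show "\<kappa> * (Hnorm 1 u)\<^sup>2 \<le> graph_form a u u"
    unfolding graph_form_def Hnorm1_square power2_norm_eq_inner[of u] by (simp add: distrib_left)
  have "1 * (norm u)\<^sup>2 \<le> (1 / \<kappa>) * (norm u)\<^sup>2" using k by (intro mult_right_mono) auto
  with aform_upper[OF assms(1) 0, of u]
  show "graph_form a u u \<le> (1 / \<kappa>) * (Hnorm 1 u)\<^sup>2"
    unfolding graph_form_def Hnorm1_square power2_norm_eq_inner[of u] by (simp add: distrib_left add_divide_distrib)
qed

text \<open>Symmetry of the form permits this expansion. It leaves a nonnegative term [u - v, u - v]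
  to discard and compares [u,u] with [v,v] at constant 1, which a Cauchy-Schwarz estimate of the
  mixed term would not do.\<close>

lemma graph_form_polarization:
  assumes "standing_hyps T \<kappa> a" "0 \<le> T" "u \<in> H1" "v \<in> H1"
  shows "2 * graph_form a u (u - v) =
    graph_form a u u + graph_form a (u - v) (u - v) - graph_form a v v"
proof -
  have 0: "0 \<in> {0..T}" using assms(2) by simp
  note bm = standing_hyps_bounded_measurable[OF assms(1) 0]
  note c = aform_commute[OF assms(1) 0]
  note R = aform_diff_right[of a 0, OF bm assms(3,4)]
  have "aform a 0 (u - v) (u - v) = aform a 0 u u - aform a 0 u v - (aform a 0 v u - aform a 0 v v)"
    unfolding R c[of "u - v"] ..
  then show ?thesis
    unfolding graph_form_def R c[of v u]
    by (simp add: inner_diff_left inner_diff_right inner_commute)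
qed

lemma regularized_estimate:
  assumes hyps: "standing_hyps T \<kappa> a" "0 \<le> T" and S: "bounded_linear S" "is_adjoint S S'"
    and u: "u \<in> H1" and v: "v \<in> H1" and \<alpha>: "0 < \<alpha>"
    and eq: "\<And>h. h \<in> H1 \<Longrightarrow> \<alpha> * graph_form a u h + S u \<bullet> S h = S' g \<bullet> h"
    and g: "norm (g - S v) \<le> \<delta>"
  shows "\<alpha> * graph_form a u u + (norm (S u - S v))\<^sup>2 \<le> \<delta>\<^sup>2 + \<alpha> * graph_form a v v"
proof -
  interpret S: bounded_linear S by (rule S)
  let ?w = "u - v"
  have "\<alpha> * graph_form a u ?w + S u \<bullet> S ?w = g \<bullet> S ?w"
    using eq[OF H1_diff[OF u v]] S(2) by (simp add: is_adjoint_def inner_commute)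
  then have "\<alpha> * graph_form a u ?w + (norm (S ?w))\<^sup>2 = (g - S v) \<bullet> S ?w"
    by (simp add: S.diff power2_norm_eq_inner inner_diff_left)
  also have "\<dots> \<le> norm (g - S v) * norm (S ?w)" by (rule norm_cauchy_schwarz)
  also have "\<dots> \<le> \<delta> * norm (S ?w)" using g by (intro mult_right_mono) auto
  \<comment> \<open>The identity is doubled so that one full square of \<open>norm (S ?w)\<close>
    remains after Young's inequality has used up the other.\<close>
  finally have "\<alpha> * (2 * graph_form a u ?w) + 2 * (norm (S ?w))\<^sup>2 \<le> 2 * (\<delta> * norm (S ?w))" by simp
  moreover have "2 * (\<delta> * norm (S ?w)) \<le> \<delta>\<^sup>2 + (norm (S ?w))\<^sup>2"
    using sum_squares_bound[of \<delta> "norm (S ?w)"] by simp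
  moreover have "0 \<le> \<alpha> * graph_form a ?w ?w"
  proof -
    have "0 < \<kappa>" using hyps(1) by (simp add: standing_hyps_def elliptic_coeff_def)
    then have "0 \<le> \<kappa> * (Hnorm 1 ?w)\<^sup>2" by simp
    also have "\<dots> \<le> graph_form a ?w ?w" by (rule graph_form_lower[OF hyps])
    finally show ?thesis using \<alpha> by simp
  qed
  ultimately show ?thesis
    unfolding graph_form_polarization[OF hyps u v] by (simp add: algebra_simps S.diff)
qed

text \<open>Here l = |ln \<delta>| is compared with 4 ln c. Beyond this threshold c is at most
  \<delta>^(-1/4), hence d is at most \<delta>^(1/4), and replacing ln d by ln \<delta> costs the
  factor \<open>4 powr \<theta>\<close>. The two summands of the constant belong to the two
  cases.\<close>

lemma log_rate_transfer:
  fixes d \<delta> c \<theta> K B s :: real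
  assumes c: "1 < c" and \<delta>: "0 < \<delta>" and d: "0 \<le> d" "d \<le> c * sqrt \<delta>" "c * sqrt \<delta> < 1"
    and K: "0 < K" and \<theta>: "0 < \<theta>" and B: "0 \<le> B"
    and s: "s \<le> K * (1 / \<bar>ln d\<bar> powr \<theta>)" "s \<le> B"
  shows "s \<le> (K * 4 powr \<theta> + B * (4 * ln c) powr \<theta>) * (1 / \<bar>ln \<delta>\<bar> powr \<theta>)"
proof -
  define l where "l = - ln \<delta>"
  have lc: "0 < ln c" using c by simp
  have "ln (c * sqrt \<delta>) < 0" using d(3) c \<delta> by (simp add: ln_less_zero)
  moreover have "ln (c * sqrt \<delta>) = ln c - l / 2"
    using c \<delta> by (simp add: l_def ln_mult ln_sqrt)
  ultimately have l: "0 < l" and lnD: "ln (c * sqrt \<delta>) = ln c - l / 2" using lc by linarith+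
  have abs: "\<bar>ln \<delta>\<bar> = l" using l by (simp add: l_def)
  have "s \<le> K * 4 powr \<theta> * (1 / l powr \<theta>) + B * (4 * ln c) powr \<theta> * (1 / l powr \<theta>)"
  proof (cases "l \<le> 4 * ln c")
    case True
    have "l powr \<theta> \<le> (4 * ln c) powr \<theta>" using True l \<theta> by (intro powr_mono2) auto
    then have "1 \<le> (4 * ln c) powr \<theta> * (1 / l powr \<theta>)" using l by (simp add: field_simps)
    from mult_left_mono[OF this B] s(2)
    have "s \<le> B * (4 * ln c) powr \<theta> * (1 / l powr \<theta>)" by (simp add: mult.assoc)
    moreover have "0 \<le> K * 4 powr \<theta> * (1 / l powr \<theta>)" using K by simp
    ultimately show ?thesis by linarith
  next
    case False
    have "s \<le> K * 4 powr \<theta> * (1 / l powr \<theta>)"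
    proof (cases "d = 0")
      case True
      \<comment> \<open>With \<open>ln 0 = 0\<close>, \<open>0 powr \<theta> = 0\<close> and
        division by zero giving 0, the stability bound reads s \<le> 0.\<close>
      then have "s \<le> 0" using s(1) by simp
      also have "0 \<le> K * 4 powr \<theta> * (1 / l powr \<theta>)" using K by simp
      finally show ?thesis .
    next
      case nz: False
      then have "ln d \<le> ln (c * sqrt \<delta>)" using d by simp
      \<comment> \<open>The logarithm of c \<delta>^(1/2) is ln c - l/2, which is below -l/4 because
        ln c < l/4.\<close>
      with lnD False have ln_d: "l / 4 \<le> \<bar>ln d\<bar>" by linarith
      have "1 / \<bar>ln d\<bar> powr \<theta> \<le> 1 / (l / 4) powr \<theta>"
        using ln_d l \<theta> by (intro divide_left_mono powr_mono2 mult_pos_pos) auto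
      also have "\<dots> = 4 powr \<theta> * (1 / l powr \<theta>)" using l by (simp add: powr_divide)
      finally have "1 / \<bar>ln d\<bar> powr \<theta> \<le> 4 powr \<theta> * (1 / l powr \<theta>)" .
      from mult_left_mono[OF this, of K] K s(1) show ?thesis by (simp add: mult.assoc)
    qed
    moreover have "0 \<le> B * (4 * ln c) powr \<theta> * (1 / l powr \<theta>)" using B by simp
    ultimately show ?thesis by linarith
  qed
  then show ?thesis unfolding abs distrib_right .
qed

text \<open>The constant is that of \<open>log_rate_transfer\<close> with c = M^(1/2) (1 + E) /
  \<kappa> and with the a priori bound 2 M (1 + E) / \<kappa>^2 in place of B.\<close>

lemma regularized_error_bound:
  fixes a :: "'n::finite coeff" and ubar :: "real \<Rightarrow> 'n L2"
  assumes T: "0 < T" and hyps: "standing_hyps T \<kappa> a" and ev: "evolution_family T a U M"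
    and adj: "is_adjoint (U T 0) U_star" and E: "0 < E" and ubar: "solution_P T a ubar"
    and ubar0: "Hnorm 1 (ubar 0) \<le> E"
    and stab: "stability_constants TYPE('n) (A_LL T a) (A_Lip T a) \<kappa> T ((1 + E) / \<kappa>\<^sup>2) \<rho> \<theta> K"
    and \<delta>: "0 < \<delta>" and g: "norm (g - ubar T) < \<delta>" and ug: "ug \<in> Hs 1"
    and eq: "\<forall>h\<in>Hs 1. b_form T a U (\<delta> * M * \<kappa>) ug h = U_star g \<bullet> h"
    and small: "sqrt M / \<kappa> * (1 + E) * sqrt \<delta> < \<rho>"
  shows "(SUP t\<in>{0..T}. norm (U t 0 ug - ubar t)) \<le>
    (K * 4 powr \<theta> + 2 * M * ((1 + E) / \<kappa>\<^sup>2) * (4 * ln (sqrt M / \<kappa> * (1 + E))) powr \<theta>)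
      * (1 / \<bar>ln \<delta>\<bar> powr \<theta>)"
proof -
  have k: "0 < \<kappa>" "\<kappa> \<le> 1" using hyps by (auto simp: standing_hyps_def elliptic_coeff_def)
  have M: "0 < M" using ev by (simp add: evolution_family_def)
  have \<rho>: "\<rho> < 1" and \<theta>: "0 < \<theta>" and K: "0 < K" using stab by (auto simp: stability_constants_def)
  have blin: "bounded_linear (U t 0)" if "t \<in> {0..T}" for t
    using ev that by (auto simp: evolution_family_def)
  have U_0: "U 0 0 u = u" for u using ev T by (auto simp: evolution_family_def)
  have U_bound: "norm (U t 0 u) \<le> M * norm u" if "t \<in> {0..T}" for t u
  proof -
    have "\<forall>u\<in>Hs 0. U t 0 u \<in> Hs 0 \<and> Hnorm 0 (U t 0 u) \<le> M * Hnorm 0 u"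
      using ev that unfolding evolution_family_def by fastforce
    then show ?thesis by (simp add: Hs_def Hnorm_def)
  qed
  have U_sol: "solution_P T a (\<lambda>p. U p 0 u)" if "u \<in> Hs 1" for u
  proof -
    have "\<forall>s\<in>{0..T}. \<forall>\<sigma>\<in>{0..2}. \<forall>us\<in>Hs \<sigma>.
        Hs_continuous_on \<sigma> {s..T} (\<lambda>p. U p s us) \<and>
        Hs_continuous_on 2 {s<..T} (\<lambda>p. U p s us) \<and>
        C1_satisfies_P s T a (\<lambda>p. U p s us)"
      using ev unfolding evolution_family_def by blast
    moreover have "(0::real) \<in> {0..T}" "(1::real) \<in> {0..2}" using T by auto
    ultimately show ?thesis using that unfolding solution_P_def by blast
  qed
  have u0: "ubar 0 \<in> Hs 1"
    using ubar T by (auto simp: solution_P_def Hs_continuous_on_def)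
  have ubar_eq: "ubar t = U t 0 (ubar 0)" if "t \<in> {0..T}" for t
    by (rule solution_unique[OF hyps ubar U_sol[OF u0] _ that]) (simp add: U_0)
  define c where "c = sqrt M / \<kappa> * (1 + E)"
  define E' where "E' = (1 + E) / \<kappa>\<^sup>2"
  have k2: "\<kappa>\<^sup>2 \<le> 1" using k by (simp add: power_le_one)
  have "(1 + E) * \<kappa>\<^sup>2 \<le> (1 + E) * 1" using k2 E by (intro mult_left_mono) auto
  then have EE': "1 + E \<le> E'" unfolding E'_def using k by (simp add: pos_le_divide_eq)
  show ?thesis
  \<comment> \<open>A nonzero class is wanted only to deduce M \<ge> 1. Splitting on its existence
    avoids constructing one; in the trivial space the left-hand side is 0.\<close>
  proof (cases "\<exists>x :: 'n L2. x \<noteq> 0")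
    case False
    then have "norm (U t 0 ug - ubar t) = 0" for t by auto
    then have "(SUP t\<in>{0..T}. norm (U t 0 ug - ubar t)) = 0" using T by simp
    also have "0 \<le> (K * 4 powr \<theta> + 2 * M * ((1 + E) / \<kappa>\<^sup>2) * (4 * ln (sqrt M / \<kappa> * (1 + E))) powr \<theta>)
      * (1 / \<bar>ln \<delta>\<bar> powr \<theta>)" using K M E by simp
    finally show ?thesis .
  next
    case True
    then obtain x :: "'n L2" where x: "x \<noteq> 0" by blast
    \<comment> \<open>U(0,0) is the identity, so its norm bound forces M \<ge> 1. This makes c > 1,
      hence ln c > 0.\<close>
    have "1 * norm x \<le> M * norm x" using U_bound[of 0 x] T by (simp add: U_0)
    with x have M1: "1 \<le> M" by simp
    have "1 \<le> sqrt M / \<kappa>"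
    proof -
      have "\<kappa> \<le> sqrt M" using k M1 by (meson order_trans real_sqrt_ge_one)
      then show ?thesis using k by simp
    qed
    then have "1 * (1 + E) \<le> c" unfolding c_def using E by (intro mult_right_mono) auto
    with E have c: "1 < c" by simp
    have csmall: "c * sqrt \<delta> < \<rho>" using small by (simp add: c_def)
    have D2: "(c * sqrt \<delta>)\<^sup>2 = M * (1 + E)\<^sup>2 / \<kappa>\<^sup>2 * \<delta>"
      unfolding c_def using M \<delta> by (simp add: power_mult_distrib power_divide)
    \<comment> \<open>From \<rho> < 1 the smallness assumption yields M (1 + E)^2 \<delta> <
      \<kappa>^2, and from it \<delta> \<le> \<kappa>^2 \<le> 1.\<close>
    have "(c * sqrt \<delta>)\<^sup>2 < 1"
      using csmall \<rho> c \<delta> by (intro power_less_one_iff[THEN iffD2]) auto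
    then have \<delta>_small: "M * (1 + E)\<^sup>2 * \<delta> < \<kappa>\<^sup>2"
      unfolding D2 using k by (simp add: field_simps)
    have T0: "T \<in> {0..T}" "0 \<in> {0..T}" and T': "0 \<le> T" using T by auto
    let ?S = "U T 0" and ?v = "ubar 0"
    \<comment> \<open>The factor \<kappa> cancels the 1/\<kappa> of the upper form bound, so the
      energy of \<open>?v\<close> contributes at most \<delta> M E^2. The factor \<delta> makes this
      homogeneous with the data error: dividing by \<delta> bounds \<open>ug\<close> in H^1
      uniformly in \<delta>.\<close>
    define \<alpha> where "\<alpha> = \<delta> * M * \<kappa>"
    have \<alpha>: "0 < \<alpha>" using \<delta> M k by (simp add: \<alpha>_def)
    have H: "ug \<in> H1" "?v \<in> H1" using ug u0 by (auto simp: Hs_1)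
    have reg: "\<alpha> * graph_form a ug ug + (norm (?S ug - ?S ?v))\<^sup>2 \<le> \<delta>\<^sup>2 + \<alpha> * graph_form a ?v ?v"
    proof (rule regularized_estimate[OF hyps T' blin[OF T0(1)] adj H \<alpha>])
      show "\<alpha> * graph_form a ug h + ?S ug \<bullet> ?S h = U_star g \<bullet> h" if "h \<in> H1" for h
        using eq that by (simp add: Hs_1 b_form_def graph_form_def \<alpha>_def)
      show "norm (g - ?S ?v) \<le> \<delta>" using g ubar_eq[OF T0(1)] by simp
    qed
    have Hn: "0 \<le> Hnorm 1 u" for u :: "'n L2"
      using norm_le_Hnorm1[of u] norm_ge_zero[of u] by linarith
    have "(Hnorm 1 ?v)\<^sup>2 \<le> E\<^sup>2" using ubar0 Hn by (intro power_mono) auto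
    then have "(1 / \<kappa>) * (Hnorm 1 ?v)\<^sup>2 \<le> (1 / \<kappa>) * E\<^sup>2" using k by (intro mult_left_mono) auto
    with graph_form_upper[OF hyps T', of ?v] have gv: "graph_form a ?v ?v \<le> (1 / \<kappa>) * E\<^sup>2" by linarith
    have \<alpha>gv: "\<alpha> * graph_form a ?v ?v \<le> \<delta> * M * E\<^sup>2"
      using mult_left_mono[OF gv, of \<alpha>] \<alpha> k by (simp add: \<alpha>_def)
    have "1 \<le> (1 + E)\<^sup>2" using E by (simp add: one_le_power)
    then have "1 * 1 \<le> M * (1 + E)\<^sup>2" using M1 by (intro mult_mono) auto
    then have "1 * \<delta> \<le> M * (1 + E)\<^sup>2 * \<delta>" using \<delta> by (intro mult_right_mono) auto
    with \<delta>_small have \<delta>k: "\<delta> \<le> \<kappa>\<^sup>2" by linarith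
    have glow: "\<kappa> * (Hnorm 1 ug)\<^sup>2 \<le> graph_form a ug ug" by (rule graph_form_lower[OF hyps T'])
    have "\<alpha> * (\<kappa> * (Hnorm 1 ug)\<^sup>2) \<le> \<delta>\<^sup>2 + \<delta> * M * E\<^sup>2"
      using mult_left_mono[OF glow, of \<alpha>] \<alpha> reg \<alpha>gv zero_le_power2[of "norm (?S ug - ?S ?v)"] by linarith
    then have "\<delta> * (M * \<kappa>\<^sup>2 * (Hnorm 1 ug)\<^sup>2) \<le> \<delta> * (\<delta> + M * E\<^sup>2)"
      by (simp add: \<alpha>_def power2_eq_square algebra_simps)
    then have "M * \<kappa>\<^sup>2 * (Hnorm 1 ug)\<^sup>2 \<le> \<delta> + M * E\<^sup>2" using \<delta> by simp
    \<comment> \<open>The 1 in 1 + E pays for the remaining \<delta>, since \<delta> \<le> 1 \<le>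
      M.\<close>
    also have "\<dots> \<le> M * (1 + E)\<^sup>2"
    proof -
      have "\<delta> \<le> M * 1" using \<delta>k k2 M1 by simp
      moreover have "0 \<le> M * (2 * E)" using M E by simp
      ultimately show ?thesis by (simp add: power2_sum algebra_simps)
    qed
    finally have "\<kappa>\<^sup>2 * (Hnorm 1 ug)\<^sup>2 \<le> (1 + E)\<^sup>2" using M by (simp add: mult.assoc)
    then have "(\<kappa> * Hnorm 1 ug)\<^sup>2 \<le> (1 + E)\<^sup>2" by (simp add: power_mult_distrib)
    then have "\<kappa> * Hnorm 1 ug \<le> 1 + E" by (rule power2_le_imp_le) (use E in simp)
    \<comment> \<open>The bound (1 + E)/\<kappa> just obtained is relaxed by another factor
      1/\<kappa>, to reach the radius \<open>E'\<close> to which the stability constants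
      refer.\<close>
    then have "\<kappa> * (\<kappa> * Hnorm 1 ug) \<le> 1 * (1 + E)" using k E Hn by (intro mult_mono) auto
    then have ugE: "Hnorm 1 ug \<le> E'" unfolding E'_def using k
      by (simp add: pos_le_divide_eq power2_eq_square mult_ac)
    \<comment> \<open>The same absorption of \<delta> gives the square of the distance the bound
      \<delta> M (1 + E)^2; the further factor 1/\<kappa>^2 only matches c.\<close>
    have dist_T: "norm (U T 0 ug - ubar T) \<le> c * sqrt \<delta>"
    proof (rule power2_le_imp_le)
      have "0 \<le> graph_form a ug ug"
        by (rule order_trans[OF _ glow]) (use k in simp)
      then have "0 \<le> \<alpha> * graph_form a ug ug" using \<alpha> by simp
      then have "(norm (U T 0 ug - ubar T))\<^sup>2 \<le> \<delta> * (\<delta> + M * E\<^sup>2)"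
        using reg \<alpha>gv ubar_eq[OF T0(1)] by (simp add: power2_eq_square algebra_simps)
      also have "\<dots> \<le> \<delta> * (M * (1 + E)\<^sup>2 / \<kappa>\<^sup>2)"
      proof (rule mult_left_mono)
        have "\<delta> \<le> M * 1" using \<delta>k k2 M1 by simp
        moreover have "0 \<le> M * (2 * E)" using M E by simp
        ultimately have "\<delta> + M * E\<^sup>2 \<le> M * (1 + E)\<^sup>2 / 1" by (simp add: power2_sum algebra_simps)
        also have "\<dots> \<le> M * (1 + E)\<^sup>2 / \<kappa>\<^sup>2" using k k2 M by (intro divide_left_mono) auto
        finally show "\<delta> + M * E\<^sup>2 \<le> M * (1 + E)\<^sup>2 / \<kappa>\<^sup>2" .
      qed (use \<delta> in simp)
      also have "\<dots> = (c * sqrt \<delta>)\<^sup>2" unfolding D2 by simp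
      finally show "(norm (U T 0 ug - ubar T))\<^sup>2 \<le> (c * sqrt \<delta>)\<^sup>2" .
      show "0 \<le> c * sqrt \<delta>" using c \<delta> by simp
    qed
    have "(SUP t\<in>{0..T}. norm (U t 0 ug - ubar t)) \<le>
        K * (1 / \<bar>ln (norm (U T 0 ug - ubar T))\<bar> powr \<theta>)"
    proof -
      have *: "standing_hyps T \<kappa> a \<and> A_LL T a = A_LL T a \<and> A_Lip T a = A_Lip T a \<and>
          solution_P T a (\<lambda>t. U t 0 ug) \<and> solution_P T a ubar \<and> Hnorm 1 (U 0 0 ug) \<le> (1 + E) / \<kappa>\<^sup>2 \<and>
          Hnorm 1 (ubar 0) \<le> (1 + E) / \<kappa>\<^sup>2 \<and> norm (U T 0 ug - ubar T) \<le> \<rho>"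
        using hyps U_sol[OF ug] ubar ugE ubar0 EE' dist_T csmall by (auto simp: U_0 E'_def)
      have "\<forall>(b :: 'n coeff) u v.
          standing_hyps T \<kappa> b \<and> A_LL T b = A_LL T a \<and> A_Lip T b = A_Lip T a \<and>
          solution_P T b u \<and> solution_P T b v \<and>
          Hnorm 1 (u 0) \<le> (1 + E) / \<kappa>\<^sup>2 \<and> Hnorm 1 (v 0) \<le> (1 + E) / \<kappa>\<^sup>2 \<and> norm (u T - v T) \<le> \<rho> \<longrightarrow>
          (SUP t\<in>{0..T}. norm (u t - v t)) \<le> K * (1 / \<bar>ln (norm (u T - v T))\<bar> powr \<theta>)"
        using stab unfolding stability_constants_def by blast
      from this[rule_format, of a "\<lambda>t. U t 0 ug" ubar, OF *] show ?thesis .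
    qed
    \<comment> \<open>This bound needs no smallness of the final difference; it serves the range
      where \<delta> is not small compared with c^(-4).\<close>
    moreover have "(SUP t\<in>{0..T}. norm (U t 0 ug - ubar t)) \<le> 2 * M * E'"
    proof (rule cSUP_least)
      fix t assume t: "t \<in> {0..T}"
      interpret Ut: bounded_linear "U t 0" by (rule blin[OF t])
      have "norm (U t 0 ug - ubar t) \<le> M * norm (ug - ?v)"
        using U_bound[OF t, of "ug - ?v"] by (simp add: ubar_eq[OF t] Ut.diff)
      also have "\<dots> \<le> M * (E' + E')"
      proof (rule mult_left_mono)
        have "norm ug \<le> E'" "norm ?v \<le> E'"
          using norm_le_Hnorm1[of ug] norm_le_Hnorm1[of ?v] ugE ubar0 EE' by linarith+
        then show "norm (ug - ?v) \<le> E' + E'" using norm_triangle_ineq4[of ug ?v] by linarith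
      qed (use M in simp)
      finally show "norm (U t 0 ug - ubar t) \<le> 2 * M * E'" by (simp add: mult_ac)
    qed (use T in simp)
    ultimately show ?thesis
      unfolding c_def[symmetric] E'_def[symmetric]
      by (intro log_rate_transfer[OF c \<delta> norm_ge_zero dist_T _ K \<theta>])
        (use csmall \<rho> M E EE' in auto)
  qed
qed

theorem theorem3p5:
  shows "\<exists>K' :: real \<Rightarrow> real \<Rightarrow> real \<Rightarrow> real \<Rightarrow> real \<Rightarrow> real.
    \<forall>(T::real) (\<kappa>::real) (a :: 'n::finite coeff) (U :: real \<Rightarrow> real \<Rightarrow> 'n L2 \<Rightarrow> 'n L2)
      (U_star :: 'n L2 \<Rightarrow> 'n L2) (M::real) (E::real) (ubar :: real \<Rightarrow> 'n L2)
      (\<rho>::real) (\<theta>::real) (K::real) (\<delta>::real) (g :: 'n L2) (ug :: 'n L2).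
      0 < T \<and> standing_hyps T \<kappa> a \<and>
      evolution_family T a U M \<and> is_adjoint (U T 0) U_star \<and>
      0 < E \<and> solution_P T a ubar \<and> Hnorm 1 (ubar 0) \<le> E \<and>
      stability_constants TYPE('n) (A_LL T a) (A_Lip T a) \<kappa> T ((1 + E) / \<kappa>\<^sup>2) \<rho> \<theta> K \<and>
      0 < \<delta> \<and> norm (g - ubar T) < \<delta> \<and>
      ug \<in> Hs 1 \<and> (\<forall>h\<in>Hs 1. b_form T a U (\<delta> * M * \<kappa>) ug h = U_star g \<bullet> h) \<and>
      sqrt M / \<kappa> * (1 + E) * sqrt \<delta> < \<rho>
      \<longrightarrow> (SUP t\<in>{0..T}. norm (U t 0 ug - ubar t)) \<le> K' K \<theta> \<kappa> M E * (1 / \<bar>ln \<delta>\<bar> powr \<theta>)"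
  by (intro exI[of _ "\<lambda>K \<theta> \<kappa> M E. K * 4 powr \<theta> +
      2 * M * ((1 + E) / \<kappa>\<^sup>2) * (4 * ln (sqrt M / \<kappa> * (1 + E))) powr \<theta>"] allI impI)
    (elim conjE, rule regularized_error_bound)

end
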